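(* For every $n\ge0$ and every $p>0$, $H_p^{gl}(\Delta^n)=0$, where $\Delta^n$ is the free $\omega$-category generated by the faces of the $n$-simplex.
   Context: **$\omega$-categories.** An $\omega$-category is a strict globular $\omega$-category in one-set form: a set $\mathcal C$ with operations $( *_n,s_n,t_n)_{n\ge0}$, each $(\mathcal C,*_n,s_n,t_n)$ being a category ($x*_ny$ is defined iff $t_nx=s_ny$), each pair $m<n$ giving a strict 2-category, and such that each $x$ satisfies $s_nx=t_nx=x$ for some $n$; the least such $n$ is the dimension of $x$. $\mathcal C_n$ is the set of morphisms of dimension exactly $n$. $\mathcal C$ is *non-contracting* if $s_1x,t_1x$ have dimension exactly $1$ whenever $\dim x>0$ ($\Delta^n$ is non-contracting). Then $\mathbb P\mathcal C$ is the $\omega$-category of all morphisms of $\mathcal C$ of dimension $>0$, with $*_i^{\mathbb P\mathcal C}=*_{i+1}^{\mathcal C}$, $s_i^{\mathbb P\mathcal C}=s_{i+1}^{\mathcal C}$, $t_i^{\mathbb P\mathcal C}=t_{i+1}^{\mathcal C}$. **$\Delta^n$.** Faces of the $n$-simplex are non-empty strictly increasing sequences $(\sigma_0\dots\sigma_r)$ in $\{0,\dots,n\}$, of dimension $r$. $R(x)$ is the set of subfaces of a face $x$ (including $x$), $R(X)=\bigcup_{x\in X}R(x)$. $\Delta^n$ is the free $\omega$-category generated by the $R(x)$ with the rules: for $x$ of dimension $p\ge1$, $s_{p-1}R(x)=R(s_x)$, $t_{p-1}R(x)=R(t_x)$, where $s_x$ (resp. $t_x$) is the set of faces obtained from $x$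 by removing one element in odd (resp. even) position (positions counted from 1); and if $t_p(X)=s_p(Y)$, then $X\cup Y\in\Delta^n$ and $X*_pY=X\cup Y$. Write $x(\sigma)$ for $x(R(\sigma))$. **Globular homology.** The globular nerve of a non-contracting $\mathcal C$ is the augmented simplicial set $\mathcal N^{gl}_n(\mathcal C)=\omega Cat(\Delta^n,\mathbb P\mathcal C)$ (the set of $\omega$-functors) for $n\ge0$, with $(\partial_ix)(\sigma)=x(\delta_i\sigma)$, $(\epsilon_ix)(\sigma)=x(\eta_i\sigma)$, where $\delta_i$ is the increasing injection missing $i$ and $\eta_i$ the non-decreasing surjection hitting $i$ twice; $\mathcal N^{gl}_{-1}(\mathcal C)=\mathcal C_0\times\mathcal C_0$, with augmentation $\partial_{-1}x=(s_0x,t_0x)$ on $\mathcal N^{gl}_0(\mathcal C)=\mathcal C_1$. For $n\ge-1$, $H^{gl}_{n+1}(\mathcal C)=H_n(\mathcal N^{gl}(\mathcal C))$, where for an augmented simplicial set $X$, $H_n(X)$ is the usual simplicial homology for $n\ge1$, $H_0(X)=\ker(\partial_{-1}:\mathbb ZX_0\to\mathbb ZX_{-1})/\mathrm{Im}(\partial_0-\partial_1)$, $H_{-1}(X)=\mathbb ZX_{-1}/\mathrm{Im}(\partial_{-1})$. *)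

theory Defs
  imports "HOL-Algebra.Free_Abelian_Groups"
begin

section \<open>Globular data in one-set form\<close>

(* The operations of a one-set omega-category; gcomp C i x y is x *_i y and is only meaningful
   when tgt C i x = src C i y. *)
record 'a omega_cat =
  cells :: "'a set"
  gcomp :: "nat \<Rightarrow> 'a \<Rightarrow> 'a \<Rightarrow> 'a"
  src   :: "nat \<Rightarrow> 'a \<Rightarrow> 'a"
  tgt   :: "nat \<Rightarrow> 'a \<Rightarrow> 'a"

definition cell_dim :: "'a omega_cat \<Rightarrow> 'a \<Rightarrow> nat" where
  "cell_dim C x = (LEAST n. src C n x = x \<and> tgt C n x = x)"

definition cells_of_dim :: "'a omega_cat \<Rightarrow> nat \<Rightarrow> 'a set" where
  "cells_of_dim C n = {x \<in> cells C. cell_dim C x = n}"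

(* Functors are required to be undefined outside the domain, so that equality of functors is
   equality of functions. *)
definition omega_functors :: "'a omega_cat \<Rightarrow> 'b omega_cat \<Rightarrow> ('a \<Rightarrow> 'b) set" where
  "omega_functors C D = {f \<in> cells C \<rightarrow>\<^sub>E cells D.
     (\<forall>i. \<forall>x \<in> cells C. f (src C i x) = src D i (f x) \<and> f (tgt C i x) = tgt D i (f x)) \<and>
     (\<forall>i. \<forall>x \<in> cells C. \<forall>y \<in> cells C.
        tgt C i x = src C i y \<longrightarrow> f (gcomp C i x y) = gcomp D i (f x) (f y))}"

definition path_cat :: "'a omega_cat \<Rightarrow> 'a omega_cat" where
  "path_cat C = \<lparr>cells = {x \<in> cells C. cell_dim C x > 0},
     gcomp = (\<lambda>i. gcomp C (Suc i)), src = (\<lambda>i. src C (Suc i)), tgt = (\<lambda>i. tgt C (Suc i))\<rparr>"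


section \<open>The omega-category of the n-simplex\<close>

(* A non-empty strictly increasing sequence in {0..n} is represented by its set of entries. *)
definition simplex_face :: "nat \<Rightarrow> nat set \<Rightarrow> bool" where
  "simplex_face n x \<longleftrightarrow> x \<noteq> {} \<and> x \<subseteq> {..n}"

definition face_dim :: "nat set \<Rightarrow> nat" where
  "face_dim x = card x - 1"

definition subfaces :: "nat set \<Rightarrow> nat set set" where
  "subfaces x = {y. y \<noteq> {} \<and> y \<subseteq> x}"

definition subfaces_of :: "nat set set \<Rightarrow> nat set set" where
  "subfaces_of X = (\<Union>x\<in>X. subfaces x)"

definition entry_position :: "nat set \<Rightarrow> nat \<Rightarrow> nat" where
  "entry_position x v = card {u \<in> x. u \<le> v}"

definition odd_faces :: "nat set \<Rightarrow> nat set set" where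
  "odd_faces x = {x - {v} | v. v \<in> x \<and> odd (entry_position x v)}"

definition even_faces :: "nat set \<Rightarrow> nat set set" where
  "even_faces x = {x - {v} | v. v \<in> x \<and> even (entry_position x v)}"

(* simplex_cell n X S T: the set of faces X belongs to the omega-category generated by the
   subfaces x, and S q, T q are its q-dimensional source and target.
   In the rule atom, x has dimension p + 1. Its source and target in dimension p are given by the
   odd and even faces; below p they are forced by the globular identities s_q s_p = s_q and
   t_q t_p = t_q, and from dimension p + 1 on by the dimension of x.
   In the rule comp, the sources and targets of X *_p Y = X \<union> Y are those forced by the axioms of
   an omega-category: s_q is s_q X for q <= p and (s_q X) *_p (s_q Y) for q > p; t_q is t_q Y for
   q <= p and (t_q X) *_p (t_q Y) for q > p.
   Since the composite is prescribed to be the union, a cell is determined by its set of faces: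
   the omega-category is the smallest family of sets of faces closed under these rules.
   (That it is moreover the free omega-category on its atoms is a theorem of Street.) *)
inductive simplex_cell ::
  "nat \<Rightarrow> nat set set \<Rightarrow> (nat \<Rightarrow> nat set set) \<Rightarrow> (nat \<Rightarrow> nat set set) \<Rightarrow> bool" for n :: nat
where
  vertex: "v \<le> n \<Longrightarrow> simplex_cell n (subfaces {v}) (\<lambda>q. subfaces {v}) (\<lambda>q. subfaces {v})"
| atom: "\<lbrakk>simplex_face n x; face_dim x = Suc p;
          simplex_cell n (subfaces_of (odd_faces x)) S S';
          simplex_cell n (subfaces_of (even_faces x)) T' T\<rbrakk>
    \<Longrightarrow> simplex_cell n (subfaces x)
          (\<lambda>q. if q < p then S q else if q = p then subfaces_of (odd_faces x) else subfaces x)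
          (\<lambda>q. if q < p then T q else if q = p then subfaces_of (even_faces x) else subfaces x)"
| comp: "\<lbrakk>simplex_cell n X S T; simplex_cell n Y S' T'; T p = S' p\<rbrakk>
    \<Longrightarrow> simplex_cell n (X \<union> Y)
          (\<lambda>q. if q \<le> p then S q else S q \<union> S' q)
          (\<lambda>q. if q \<le> p then T' q else T q \<union> T' q)"

definition simplex_cat :: "nat \<Rightarrow> nat set set omega_cat" where
  "simplex_cat n = \<lparr>
     cells = {X. \<exists>S T. simplex_cell n X S T},
     gcomp = (\<lambda>p X Y. X \<union> Y),
     src = (\<lambda>p X. THE Z. \<exists>S T. simplex_cell n X S T \<and> Z = S p),
     tgt = (\<lambda>p X. THE Z. \<exists>S T. simplex_cell n X S T \<and> Z = T p)\<rparr>"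


section \<open>Augmented simplicial sets and their homology\<close>

(* face X m i : X_m --> X_(m-1) for m >= 1 and degen X m i : X_m --> X_(m+1), where i <= m in both
   cases; base X is the set X_(-1). *)
record ('x, 'b) aug_sset =
  simplices :: "nat \<Rightarrow> 'x set"
  face      :: "nat \<Rightarrow> nat \<Rightarrow> 'x \<Rightarrow> 'x"
  degen     :: "nat \<Rightarrow> nat \<Rightarrow> 'x \<Rightarrow> 'x"
  base      :: "'b set"
  augm      :: "'x \<Rightarrow> 'b"

definition chain_group :: "('x, 'b) aug_sset \<Rightarrow> nat \<Rightarrow> ('x \<Rightarrow>\<^sub>0 int) monoid" where
  "chain_group X m = free_Abelian_group (simplices X m)"

definition boundary :: "('x, 'b) aug_sset \<Rightarrow> nat \<Rightarrow> ('x \<Rightarrow>\<^sub>0 int) \<Rightarrow> ('x \<Rightarrow>\<^sub>0 int)" where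
  "boundary X m = frag_extend (\<lambda>x. \<Sum>i\<le>m. frag_cmul ((-1) ^ i) (frag_of (face X m i x)))"

definition augmentation :: "('x, 'b) aug_sset \<Rightarrow> ('x \<Rightarrow>\<^sub>0 int) \<Rightarrow> ('b \<Rightarrow>\<^sub>0 int)" where
  "augmentation X = frag_extend (\<lambda>x. frag_of (augm X x))"

definition cycles :: "('x, 'b) aug_sset \<Rightarrow> nat \<Rightarrow> ('x \<Rightarrow>\<^sub>0 int) set" where
  "cycles X m = {c \<in> carrier (chain_group X m).
     if m = 0 then augmentation X c = 0 else boundary X m c = 0}"

definition boundaries :: "('x, 'b) aug_sset \<Rightarrow> nat \<Rightarrow> ('x \<Rightarrow>\<^sub>0 int) set" where
  "boundaries X m = boundary X (Suc m) ` carrier (chain_group X (Suc m))"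

definition aug_homology :: "('x, 'b) aug_sset \<Rightarrow> nat \<Rightarrow> ('x \<Rightarrow>\<^sub>0 int) set monoid" where
  "aug_homology X m = subgroup_generated (chain_group X m) (cycles X m) Mod boundaries X m"


section \<open>The globular nerve and globular homology\<close>

definition coface :: "nat \<Rightarrow> nat \<Rightarrow> nat" where
  "coface i k = (if k < i then k else Suc k)"

definition codegen :: "nat \<Rightarrow> nat \<Rightarrow> nat" where
  "codegen i k = (if k \<le> i then k else k - 1)"

(* The functor between the omega-categories of simplices induced by a monotone map of vertices;
   by the lemma below it sends the atom of a face to the atom of the image face. *)
definition simplex_map :: "(nat \<Rightarrow> nat) \<Rightarrow> nat set set \<Rightarrow> nat set set" where
  "simplex_map f X = (\<lambda>\<sigma>. f ` \<sigma>) ` X"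

lemma simplex_map_subfaces: "simplex_map f (subfaces \<sigma>) = subfaces (f ` \<sigma>)"
  unfolding simplex_map_def subfaces_def by (auto simp: subset_image_iff image_iff)

(* The augmentation identifies a functor x on the 0-simplex with the 1-morphism x((0)). *)
definition globular_nerve :: "'a omega_cat \<Rightarrow> (nat set set \<Rightarrow> 'a, 'a \<times> 'a) aug_sset" where
  "globular_nerve C = \<lparr>
     simplices = (\<lambda>m. omega_functors (simplex_cat m) (path_cat C)),
     face = (\<lambda>m i x. \<lambda>X \<in> cells (simplex_cat (m - 1)). x (simplex_map (coface i) X)),
     degen = (\<lambda>m i x. \<lambda>X \<in> cells (simplex_cat (Suc m)). x (simplex_map (codegen i) X)),
     base = cells_of_dim C 0 \<times> cells_of_dim C 0,
     augm = (\<lambda>x. (src C 0 (x (subfaces {0})), tgt C 0 (x (subfaces {0}))))\<rparr>"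

(* Only for p >= 1: the group in degree 0, the quotient of the free abelian group on
   base (globular_nerve C), consists of classes of a different type. *)
definition globular_homology ::
  "'a omega_cat \<Rightarrow> nat \<Rightarrow> ((nat set set \<Rightarrow> 'a) \<Rightarrow>\<^sub>0 int) set monoid" where
  "globular_homology C p = aug_homology (globular_nerve C) (p - 1)"

end

theory Submission
  imports Defs
begin

text \<open>Since all composites are unions, a functor from a simplex to the path category of the n-simplex
  is given by its values on atoms, and any values with the right sources and targets in the top dimensions
  occur (provided that the sources and targets of a cell depend only on its set of faces). Every
  component of the path category, consisting of the cells with 0-target a and 0-source b, has the
  edge from b to a as a terminal object: joining all faces of a cell Y with the vertex a
  gives a cell, whose q-source is the q-source of Y together with the cone over the (q - 1)-target of Y and whose
  q-target is the cone over the (q - 1)-source of Y. Applied to the values on atoms, this cone yields an extra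
  degeneracy of the globular nerve, that is, a contracting homotopy.\<close>

section \<open>Faces and monotone maps\<close>

text \<open>The obstacle is the proviso on sources and targets: a cell can be built in many ways,
  and the rules do not say that two constructions give the same boundaries. They are recovered from
  the set of faces X by a criterion: a face of dimension q lies in the q-source iff it is in X and
  is an even face of no member of X; dually for targets. For a composite of X and Y along p this
  needs, when q = p, that no face is both an odd face of a member of X and an even face of a member
  of Y. Collapsing the simplex onto such a face, a signed sum of vertices increases strictly along
  moves through cofaces, while the common p-boundary contains only one face of the fibre; this
  excludes it. A second obstacle: an atom is a cell only if its source and target are, and these
  involve cones, while cones over atoms are atoms. One induction on dimension settles both, an atom
  being the cone from its least vertex over the opposite face. The least vertex suits the
  orientation: prepending it moves every entry by one position and so exchanges odd and even, which
  is why cones over targets appear in the source of a cone.\<close>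

definition oriented_faces :: "bool \<Rightarrow> nat set \<Rightarrow> nat set set" where
  "oriented_faces e x = {x - {v} | v. v \<in> x \<and> odd (entry_position x v) = e}"

text \<open>The Boolean makes source (\<open>True\<close>) and target (\<open>False\<close>)
  statements instances of a single one; duality becomes negation of the Boolean.\<close>

lemma oriented_faces_True: "oriented_faces True = odd_faces"
  and oriented_faces_False: "oriented_faces False = even_faces"
  by (auto simp: fun_eq_iff oriented_faces_def odd_faces_def even_faces_def)

lemma oriented_faces_iff:
  "z \<in> oriented_faces e w \<longleftrightarrow> (\<exists>v. v \<notin> z \<and> w = insert v z \<and> odd (entry_position w v) = e)"
  unfolding oriented_faces_def by (auto; metis Diff_insert_absorb insertI1 insert_Diff Diff_iff)

lemma oriented_faces_subset: "z \<in> oriented_faces e x \<Longrightarrow> z \<subseteq> x"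
  by (auto simp: oriented_faces_def)

lemma card_oriented_faces: "finite x \<Longrightarrow> z \<in> oriented_faces e x \<Longrightarrow> Suc (card z) = card x"
  by (metis oriented_faces_iff card_insert_disjoint finite_insert)

lemma mem_subfaces: "z \<in> subfaces x \<longleftrightarrow> z \<noteq> {} \<and> z \<subseteq> x"
  by (simp add: subfaces_def)

lemma mem_subfaces_of: "z \<in> subfaces_of X \<longleftrightarrow> z \<noteq> {} \<and> (\<exists>x\<in>X. z \<subseteq> x)"
  by (auto simp: subfaces_of_def subfaces_def)

lemma mem_subfaces_of_oriented_faces:
  "z \<in> subfaces_of (oriented_faces e x)
     \<longleftrightarrow> z \<noteq> {} \<and> z \<subseteq> x \<and> (\<exists>v\<in>x - z. odd (entry_position x v) = e)"
proof -
  have "oriented_faces e x = (\<lambda>v. x - {v}) ` {v \<in> x. odd (entry_position x v) = e}"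
    by (auto simp: oriented_faces_def)
  then show ?thesis
    by (simp add: mem_subfaces_of) blast
qed

lemma subfaces_of_oriented_faces_subset: "subfaces_of (oriented_faces e x) \<subseteq> subfaces x"
  by (auto simp: mem_subfaces_of_oriented_faces mem_subfaces)

lemma subfaces_singleton: "subfaces {v} = {{v}}"
  by (auto simp: subfaces_def)

text \<open>The sign of \<open>v\<close> in \<open>x\<close> and its sign in
  \<open>insert v z\<close> differ by the number of missing entries below \<open>v\<close>. This
  discrepancy drives the parity argument of \<open>no_oriented_face_iff\<close>.\<close>

lemma entry_position_insert_subset:
  assumes "finite x" "z \<subseteq> x" "v \<in> x - z"
  shows "entry_position x v = entry_position (insert v z) v + card {u \<in> x - z. u < v}"
proof -
  have "{u \<in> x. u \<le> v} = {u \<in> insert v z. u \<le> v} \<union> {u \<in> x - z. u < v}"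
    using assms by auto
  moreover have "finite z"
    using assms finite_subset by blast
  moreover have "card ({u \<in> insert v z. u \<le> v} \<union> {u \<in> x - z. u < v})
      = card {u \<in> insert v z. u \<le> v} + card {u \<in> x - z. u < v}"
    by (rule card_Un_disjoint) (use assms \<open>finite z\<close> in auto)
  ultimately show ?thesis
    unfolding entry_position_def by simp
qed

text \<open>The criterion for boundaries (\<open>globular_boundary_iff\<close>) gives the same
  answer in the source of an atom, in its target and in the atom itself, so the lower boundaries of
  an atom are unambiguous. Everything is decided by parities at the missing entries
  \<open>M\<close>: the signs \<open>P v\<close> and \<open>Q v\<close> differ by the parity of
  \<open>g v\<close>, and the two smallest missing entries realise the values 0 and 1 of
  \<open>g\<close>.\<close>

lemma no_oriented_face_iff:
  assumes fin: "finite x" and zx: "z \<subseteq> x" and z: "z \<noteq> {}" and two: "Suc (Suc (card z)) \<le> card x"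
  shows "(z \<in> subfaces_of (oriented_faces c x) \<and>
            (\<forall>w\<in>subfaces_of (oriented_faces c x). z \<notin> oriented_faces e w))
         \<longleftrightarrow> (\<forall>w\<in>subfaces x. z \<notin> oriented_faces e w)"
proof -
  define M where "M = x - z"
  define P where "P v = odd (entry_position x v)" for v
  define Q where "Q v = odd (entry_position (insert v z) v)" for v
  define g where "g v = card {u \<in> M. u < v}" for v
  have finM: "finite M" and cM: "2 \<le> card M"
    using fin zx two by (auto simp: M_def card_Diff_subset finite_subset)
  have PQ: "P v = (Q v \<noteq> odd (g v))" if "v \<in> M" for v
    using entry_position_insert_subset[OF fin zx, of v] that by (auto simp: P_def Q_def g_def M_def)
  have "M \<noteq> {}" using cM by auto
  define m1 where "m1 = Min M"
  have m1: "m1 \<in> M" "\<And>u. u \<in> M \<Longrightarrow> m1 \<le> u"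
    using finM \<open>M \<noteq> {}\<close> by (auto simp: m1_def)
  have "M - {m1} \<noteq> {}"
    using cM finM by (metis card_Diff_singleton card.empty m1(1) One_nat_def Suc_1 diff_is_0_eq not_less_eq_eq)
  define m2 where "m2 = Min (M - {m1})"
  have m2: "m2 \<in> M" "m2 \<noteq> m1" "\<And>u. u \<in> M \<Longrightarrow> u \<noteq> m1 \<Longrightarrow> m2 \<le> u"
    using Min_in[of "M - {m1}"] Min_le[of "M - {m1}"] finM \<open>M - {m1} \<noteq> {}\<close> by (auto simp: m2_def)
  have "{u \<in> M. u < m1} = {}" using m1 by force
  then have g1: "g m1 = 0" by (simp add: g_def)
  have "{u \<in> M. u < m2} = {m1}" using m1 m2 by force
  then have g2: "g m2 = 1" by (simp add: g_def)
  have faces: "(\<forall>w\<in>W. z \<notin> oriented_faces e w) \<longleftrightarrow> (\<forall>v. v \<notin> z \<longrightarrow> insert v z \<in> W \<longrightarrow> Q v \<noteq> e)" for W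
    unfolding oriented_faces_iff Q_def by blast
  have R: "(\<forall>w\<in>subfaces x. z \<notin> oriented_faces e w) \<longleftrightarrow> (\<forall>v\<in>M. Q v \<noteq> e)"
    unfolding faces using zx by (auto simp: mem_subfaces M_def)
  have odd_part: "w \<in> subfaces_of (oriented_faces c x) \<longleftrightarrow> w \<noteq> {} \<and> w \<subseteq> x \<and> (\<exists>v\<in>x - w. P v = c)" for w
    by (simp only: mem_subfaces_of_oriented_faces P_def)
  have L1: "z \<in> subfaces_of (oriented_faces c x) \<longleftrightarrow> (\<exists>v\<in>M. P v = c)"
    unfolding odd_part M_def using z zx by blast
  have L2: "(\<forall>w\<in>subfaces_of (oriented_faces c x). z \<notin> oriented_faces e w) \<longleftrightarrow>
            (\<forall>v\<in>M. (\<exists>u\<in>M. u \<noteq> v \<and> P u = c) \<longrightarrow> Q v \<noteq> e)"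
    unfolding faces odd_part M_def using zx by blast
  show ?thesis
    unfolding R L1 L2
  proof (intro iffI conjI)
    assume all: "\<forall>v\<in>M. Q v \<noteq> e"
    show "\<exists>v\<in>M. P v = c"
    proof (cases "P m1 = c")
      case False
      then have "P m2 = c"
        using all m1(1) m2(1) PQ[OF m1(1)] PQ[OF m2(1)] g1 g2 by simp
      then show ?thesis using m2(1) by blast
    qed (use m1(1) in blast)
    show "\<forall>v\<in>M. (\<exists>u\<in>M. u \<noteq> v \<and> P u = c) \<longrightarrow> Q v \<noteq> e"
      using all by blast
  next
    assume H: "(\<exists>v\<in>M. P v = c) \<and> (\<forall>v\<in>M. (\<exists>u\<in>M. u \<noteq> v \<and> P u = c) \<longrightarrow> Q v \<noteq> e)"
    then have imp: "Q v \<noteq> e" if "v \<in> M" "u \<in> M" "u \<noteq> v" "P u = c" for u v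
      using that by metis
    show "\<forall>v\<in>M. Q v \<noteq> e"
    proof (intro ballI notI)
      fix v assume v: "v \<in> M" "Q v = e"
      then have other: "\<And>u. u \<in> M \<Longrightarrow> u \<noteq> v \<Longrightarrow> P u \<noteq> c" using imp by metis
      then have Pv: "P v = c" using H by metis
      show False
      \<comment> \<open>One of \<open>m1\<close>, \<open>m2\<close> has a value of \<open>g\<close>
        of parity opposite to \<open>g v\<close>, so it is not \<open>v\<close>. There both
        \<open>P\<close> and \<open>Q\<close> take the values opposite to those at \<open>v\<close>,
        whereas \<open>PQ\<close> demands that exactly one of them does.\<close>
      proof (cases "odd (g v)")
        case True
        then have "m1 \<noteq> v" using g1 by auto
        then have "P m1 \<noteq> c" "Q m1 \<noteq> e"
          using other imp[OF m1(1) v(1) _ Pv] m1(1) by simp_all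
        then show False
          using PQ[OF m1(1)] PQ[OF v(1)] v(2) Pv True g1 by simp
      next
        case False
        then have "m2 \<noteq> v" using g2 by auto
        then have "P m2 \<noteq> c" "Q m2 \<noteq> e"
          using other imp[OF m2(1) v(1) _ Pv] m2(1) by simp_all
        then show False
          using PQ[OF m2(1)] PQ[OF v(1)] v(2) Pv False g2 by simp
      qed
    qed
  qed
qed

section \<open>Images of faces under monotone maps of vertices\<close>

lemma entry_position_image:
  assumes "mono f" "inj_on f x" "v \<in> x"
  shows "entry_position (f ` x) (f v) = entry_position x v"
proof -
  have "{u \<in> f ` x. u \<le> f v} = f ` {u \<in> x. u \<le> v}"
  proof -
    have "u \<le> v" if "u \<in> x" "f u \<le> f v" for u
    proof (rule ccontr)
      assume "\<not> u \<le> v"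
      then have "f v \<le> f u" using assms(1) by (simp add: monoD)
      then have "u = v" using that assms(2,3) by (simp add: inj_on_eq_iff)
      then show False using \<open>\<not> u \<le> v\<close> by simp
    qed
    then show ?thesis
      using assms(1) by (auto dest: monoD)
  qed
  moreover have "inj_on f {u \<in> x. u \<le> v}"
    using assms(2) by (rule inj_on_subset) auto
  ultimately show ?thesis
    by (simp add: entry_position_def card_image)
qed

lemma oriented_faces_image:
  assumes "mono f" "inj_on f x"
  shows "oriented_faces e (f ` x) = (`) f ` oriented_faces e x"
proof -
  have faces: "oriented_faces e y = (\<lambda>v. y - {v}) ` {v \<in> y. odd (entry_position y v) = e}" for y
    by (auto simp: oriented_faces_def)
  have "{v \<in> f ` x. odd (entry_position (f ` x) v) = e} = f ` {v \<in> x. odd (entry_position x v) = e}"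
    using entry_position_image[OF assms] by auto
  moreover have "f ` (x - {v}) = f ` x - {f v}" if "v \<in> x" for v
    using assms(2) that by (auto simp: inj_on_def)
  ultimately show ?thesis
    unfolding faces by (simp add: image_image)
qed

text \<open>A monotone map that is not injective on \<open>x\<close> identifies two consecutive
  entries \<open>u\<close> and \<open>v\<close>. Their positions have opposite parities, so exactly
  one of \<open>x - {u}\<close> and \<open>x - {v}\<close> has orientation \<open>e\<close>, and
  both have the full image.\<close>

lemma oriented_faces_degenerate_image:
  assumes "mono f" "\<not> inj_on f x" "finite x"
  shows "\<exists>y\<in>oriented_faces e x. f ` y = f ` x"
proof -
  obtain u v0 where uv0: "u \<in> x" "v0 \<in> x" "f u = f v0" "u < v0"
    using assms(2) unfolding inj_on_def by (metis linorder_neqE_nat)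
  define v where "v = Min {w \<in> x. u < w}"
  have "v \<in> {w \<in> x. u < w}"
    unfolding v_def by (rule Min_in) (use uv0 assms(3) in auto)
  moreover have "v \<le> v0"
    unfolding v_def by (rule Min_le) (use uv0 assms(3) in auto)
  ultimately have "v \<in> {w \<in> x. u < w}" "v \<le> v0" by auto
  then have v: "v \<in> x" "u < v" by auto
  have vmin: "\<And>w. w \<in> x \<Longrightarrow> u < w \<Longrightarrow> v \<le> w"
    using assms(3) by (auto simp: v_def)
  have fuv: "f u = f v"
    using assms(1) uv0 v \<open>v \<le> v0\<close> by (metis monoD less_imp_le_nat order_antisym)
  have "{w \<in> x. w \<le> v} = insert v {w \<in> x. w \<le> u}"
    using v vmin by force
  then have pos: "entry_position x v = Suc (entry_position x u)"
    using v(2) assms(3) by (simp add: entry_position_def)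
  have "f v \<in> f ` (x - {u})" "f u \<in> f ` (x - {v})"
    by (rule imageI; use uv0(1) v in simp)+
  then have im: "f ` (x - {u}) = f ` x" "f ` (x - {v}) = f ` x"
    using fuv by (metis image_insert insert_Diff insert_absorb uv0(1) v(1))+
  show ?thesis
  proof (cases "odd (entry_position x u) = e")
    case True
    then have "x - {u} \<in> oriented_faces e x" using uv0(1) by (auto simp: oriented_faces_def)
    then show ?thesis using im by blast
  next
    case False
    then have "x - {v} \<in> oriented_faces e x" using v(1) pos by (auto simp: oriented_faces_def)
    then show ?thesis using im by blast
  qed
qed

lemma simplex_map_subfaces_of: "simplex_map f (subfaces_of X) = subfaces_of ((`) f ` X)"
  by (simp add: simplex_map_subfaces[unfolded simplex_map_def] simplex_map_def subfaces_of_def image_UN)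

lemma simplex_map_Un: "simplex_map f (X \<union> Y) = simplex_map f X \<union> simplex_map f Y"
  by (simp add: simplex_map_def image_Un)

lemma simplex_map_oriented_faces:
  assumes "mono f" "inj_on f x"
  shows "simplex_map f (subfaces_of (oriented_faces e x)) = subfaces_of (oriented_faces e (f ` x))"
  by (simp add: oriented_faces_image[OF assms] simplex_map_subfaces_of)

lemma simplex_map_oriented_faces_degenerate:
  assumes "mono f" "\<not> inj_on f x" "finite x"
  shows "simplex_map f (subfaces_of (oriented_faces e x)) = subfaces (f ` x)"
proof
  show "simplex_map f (subfaces_of (oriented_faces e x)) \<subseteq> subfaces (f ` x)"
    unfolding simplex_map_subfaces[symmetric] simplex_map_def
    by (intro image_mono subfaces_of_oriented_faces_subset)
  show "subfaces (f ` x) \<subseteq> simplex_map f (subfaces_of (oriented_faces e x))"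
    using oriented_faces_degenerate_image[OF assms, of e]
    unfolding simplex_map_subfaces_of by (fastforce simp: subfaces_def subfaces_of_def)
qed

section \<open>Globular cells\<close>

text \<open>B True q and B False q are the q-dimensional source and target. The last premises of atom and comp
  are the globular identities, which simplex_cell does not demand; they turn out to be automatic.\<close>

inductive globular_cell :: "nat set set \<Rightarrow> (bool \<Rightarrow> nat \<Rightarrow> nat set set) \<Rightarrow> bool" where
  vertex: "globular_cell (subfaces {v}) (\<lambda>e q. subfaces {v})"
| atom: "\<lbrakk>finite x; card x = Suc (Suc p);
     \<And>c. globular_cell (subfaces_of (oriented_faces c x)) (C c);
     \<And>q e. q < p \<Longrightarrow> C True e q = C False e q\<rbrakk>
    \<Longrightarrow> globular_cell (subfaces x)
          (\<lambda>e q. if q < p then C e e q else if q = p then subfaces_of (oriented_faces e x) else subfaces x)"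
| comp: "\<lbrakk>globular_cell X A; globular_cell Y B; A False p = B True p;
     \<And>q e. q < p \<Longrightarrow> A e q = B e q\<rbrakk>
    \<Longrightarrow> globular_cell (X \<union> Y)
          (\<lambda>e q. if p < q then A e q \<union> B e q else if e then A e q else B e q)"

section \<open>Elementary properties of cells and their boundaries\<close>

lemma finite_subfaces: "finite x \<Longrightarrow> finite (subfaces x)"
  by (rule finite_subset[of _ "Pow x"]) (auto simp: mem_subfaces)

lemma globular_cell_finite: "globular_cell X B \<Longrightarrow> finite X"
  by (induction rule: globular_cell.induct) (auto simp: finite_subfaces)

lemma globular_cell_nonempty: "globular_cell X B \<Longrightarrow> X \<noteq> {}"
proof (induction rule: globular_cell.induct)
  case (atom x p C)
  then have "x \<in> subfaces x" by (auto simp: mem_subfaces)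
  then show ?case by blast
qed (auto simp: subfaces_singleton)

lemma globular_cell_face: "globular_cell X B \<Longrightarrow> y \<in> X \<Longrightarrow> finite y \<and> y \<noteq> {}"
  by (induction rule: globular_cell.induct) (auto simp: mem_subfaces finite_subset)

lemma globular_cell_closed: "globular_cell X B \<Longrightarrow> y \<in> X \<Longrightarrow> z \<subseteq> y \<Longrightarrow> z \<noteq> {} \<Longrightarrow> z \<in> X"
  by (induction rule: globular_cell.induct) (auto simp: mem_subfaces)

lemma globular_boundary_subset: "globular_cell X B \<Longrightarrow> B e q \<subseteq> X"
proof (induction arbitrary: e q rule: globular_cell.induct)
  case (atom x p C)
  then show ?case
    using subfaces_of_oriented_faces_subset[of e x] order_trans[OF atom.IH subfaces_of_oriented_faces_subset]
    by simp
next
  case (comp X A Y B p)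
  then show ?case by (simp add: le_supI1 le_supI2 Un_mono)
qed simp

lemma card_subfaces_of_oriented_faces:
  assumes "finite x" "y \<in> subfaces_of (oriented_faces e x)"
  shows "card y < card x"
proof -
  have "y \<subset> x"
    using assms(2) by (auto simp: mem_subfaces_of_oriented_faces)
  then show ?thesis
    using assms(1) by (rule psubset_card_mono[rotated])
qed

lemma globular_boundary_card: "globular_cell X B \<Longrightarrow> y \<in> B e q \<Longrightarrow> card y \<le> Suc q"
proof (induction arbitrary: e q y rule: globular_cell.induct)
  case (vertex v)
  then show ?case by (simp add: subfaces_singleton)
next
  case (atom x p C)
  consider "q < p" | "q = p" | "p < q" by linarith
  then show ?case
  proof cases
    case 1
    then show ?thesis using atom.IH(1) atom.prems by auto
  next
    case 2
    then show ?thesis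
      using atom.prems atom.hyps card_subfaces_of_oriented_faces[of x y e] by simp
  next
    case 3
    then show ?thesis
      using atom.prems atom.hyps card_mono[of x y] by (auto simp: mem_subfaces)
  qed
qed (auto split: if_splits)

lemma globular_boundary_eq:
  "globular_cell X B \<Longrightarrow> (\<And>y. y \<in> X \<Longrightarrow> card y \<le> Suc q) \<Longrightarrow> B e q = X"
proof (induction arbitrary: e q rule: globular_cell.induct)
  case (vertex v)
  then show ?case by simp
next
  case (atom x p C)
  have "x \<in> subfaces x" using atom.hyps by (auto simp: mem_subfaces)
  then have "p < q" using atom.prems atom.hyps(2) by fastforce
  then show ?case by simp
next
  case (comp X A Y B p)
  have X: "A e r = X" and Y: "B e r = Y" if "q \<le> r" for r e
    using comp.IH comp.prems that by (meson UnI1 UnI2 le_trans Suc_le_mono)+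
  show ?case
  proof (cases "p < q")
    case True
    then show ?thesis using X Y by simp
  next
    case False
    \<comment> \<open>Both factors have dimension at most \<open>p\<close>, so the matching
      condition identifies them and the composite is trivial.\<close>
    then have "X = Y" using X[of p False] Y[of p True] comp.hyps(3) by simp
    then show ?thesis using X Y False by auto
  qed
qed

text \<open>Collapsing maps are included on purpose: later arguments project a whole simplex onto
  one of its faces and work with the image cell.\<close>

lemma globular_cell_simplex_map:
  assumes f: "mono f"
  shows "globular_cell X B \<Longrightarrow> globular_cell (simplex_map f X) (\<lambda>e q. simplex_map f (B e q))"
proof (induction rule: globular_cell.induct)
  case (vertex v)
  then show ?case
    using globular_cell.vertex[of "f v"] by (simp add: simplex_map_subfaces)
next
  case (atom x p C)
  show ?case
  proof (cases "inj_on f x")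
    case True
    have "globular_cell (subfaces (f ` x))
       (\<lambda>e q. if q < p then simplex_map f (C e e q)
              else if q = p then subfaces_of (oriented_faces e (f ` x)) else subfaces (f ` x))"
      by (rule globular_cell.atom[where C = "\<lambda>c e q. simplex_map f (C c e q)"])
        (use atom True in \<open>simp_all add: card_image simplex_map_oriented_faces[OF f, symmetric]\<close>)
    then show ?thesis
      by (simp add: simplex_map_subfaces simplex_map_oriented_faces[OF f True] if_distrib[of "simplex_map f"] cong: if_cong)
  next
    case False
    \<comment> \<open>Source, target and atom now have the same image, so the cell structure of the
      image is the one carried by the source, \<open>C True\<close>.\<close>
    note degen = simplex_map_oriented_faces_degenerate[OF f False atom.hyps(1)]
    have top: "C True e q = subfaces_of (oriented_faces True x)" if "p \<le> q" for e q
      by (rule globular_boundary_eq[OF atom.hyps(3)])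
        (use card_subfaces_of_oriented_faces[OF atom.hyps(1)] atom.hyps(2) that in fastforce)
    have "(\<lambda>e q. simplex_map f (if q < p then C e e q
             else if q = p then subfaces_of (oriented_faces e x) else subfaces x))
          = (\<lambda>e q. simplex_map f (C True e q))"
    proof (intro ext)
      fix e q
      show "simplex_map f (if q < p then C e e q
               else if q = p then subfaces_of (oriented_faces e x) else subfaces x)
            = simplex_map f (C True e q)"
        using atom.hyps(4)[of q e] top[of q e] by (cases e) (auto simp: degen simplex_map_subfaces)
    qed
    then show ?thesis
      using atom.IH(1)[of True] by (simp add: degen simplex_map_subfaces)
  qed
next
  case (comp X A Y B p)
  have "globular_cell (simplex_map f X \<union> simplex_map f Y)
     (\<lambda>e q. if p < q then simplex_map f (A e q) \<union> simplex_map f (B e q)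
            else if e then simplex_map f (A e q) else simplex_map f (B e q))"
    by (rule globular_cell.comp[OF comp.IH]) (use comp.hyps in auto)
  then show ?case
    by (simp add: simplex_map_Un if_distrib[of "simplex_map f"] cong: if_cong)
qed

text \<open>Omitting the vertex 0, in position 1, gives an odd face; this settles the atom. In a
  composite along \<open>r < p\<close>, \<open>disjoint\<close> keeps this face out of one of the
  factors, so it cannot enter the target through the other factor. The hypothesis
  \<open>disjoint\<close> is the induction hypothesis of \<open>globular_comp_disjoint\<close>, for
  which this lemma is the inductive step.\<close>

lemma globular_boundary_top:
  assumes disjoint: "\<And>r X A Y B z. r < p \<Longrightarrow> globular_cell X A \<Longrightarrow> globular_cell Y B \<Longrightarrow>
      A False r = B True r \<Longrightarrow> z \<in> X \<Longrightarrow> z \<in> Y \<Longrightarrow> card z \<le> Suc r"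
  shows "globular_cell X B \<Longrightarrow> \<Union>X \<subseteq> {..Suc p} \<Longrightarrow> {..Suc p} \<in> X \<Longrightarrow>
           {1..Suc p} \<in> B True p \<and> {1..Suc p} \<notin> B False p"
proof (induction rule: globular_cell.induct)
  case (vertex v)
  then have "card {..Suc p} = card {v}"
    unfolding subfaces_singleton by (metis singletonD)
  then show ?case by simp
next
  case (atom x p' C)
  have x: "x = {..Suc p}"
    using atom.prems atom.hyps(1,2) by (auto simp: mem_subfaces subfaces_def)
  then have p': "p' = p"
    using atom.hyps(2) by simp
  have "{1..Suc p} \<subseteq> x" "x - {1..Suc p} = {0}" "{u \<in> x. u \<le> 0} = {0}"
    using x by auto
  then show ?case
    unfolding p' by (simp add: mem_subfaces_of_oriented_faces entry_position_def)
next
  case (comp X A Y B r)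
  let ?t = "{..Suc p}" and ?y = "{1..Suc p}"
  have small: "card z \<le> Suc p" if "z \<in> X \<union> Y" "z \<noteq> ?t" for z
  proof -
    have "z \<subset> ?t" using that comp.prems(1) by auto
    then show ?thesis using psubset_card_mono[of ?t z] by simp
  qed
  have le: "card z \<le> Suc (Suc p)" if "z \<in> X \<union> Y" for z
    using small[OF that] by (cases "z = ?t") auto
  have X: "\<Union>X \<subseteq> ?t" and Y: "\<Union>Y \<subseteq> ?t" using comp.prems(1) by auto
  note IH = comp.IH(1)[OF X] comp.IH(2)[OF Y]
  consider "p < r" | "r = p" | "r < p" by linarith
  then show ?case
  proof cases
    case 1
    have le': "card z \<le> Suc r" if "z \<in> X \<union> Y" for z
      using le[OF that] 1 by simp
    have "A False r = X" "B True r = Y"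
      by (rule globular_boundary_eq; use comp.hyps le' in simp)+
    then show ?thesis
      using comp.hyps(3) comp.prems(2) IH 1 by simp
  next
    case 2
    \<comment> \<open>If both factors contained the top face, \<open>?y\<close> would be absent from
      \<open>A False p\<close> and present in \<open>B True p\<close>, which are equal. A factor
      without the top face has dimension at most \<open>p\<close> and equals its own
      boundary.\<close>
    have "?t \<notin> X \<or> ?t \<notin> Y"
      using IH comp.hyps(3) 2 by auto
    moreover have ?thesis if "?t \<notin> X"
    proof -
      have "A e p = X" for e
        by (rule globular_boundary_eq[OF comp.hyps(1)], rule small) (use that in auto)
      then show ?thesis
        using 2 comp.hyps(3) comp.prems(2) IH that by auto
    qed
    moreover have ?thesis if "?t \<notin> Y"
    proof -
      have "B e p = Y" for e
        by (rule globular_boundary_eq[OF comp.hyps(2)], rule small) (use that in auto)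
      then show ?thesis
        using 2 comp.hyps(3) comp.prems(2) IH that by auto
    qed
    ultimately show ?thesis by blast
  next
    case 3
    have yt: "?y \<subseteq> ?t" "?y \<noteq> {}" by auto
    have no: "\<not> (?y \<in> X \<and> ?y \<in> Y)"
      using disjoint[OF 3 comp.hyps(1,2,3), of ?y] 3 by auto
    have AX: "A False p \<subseteq> X" and BY: "B False p \<subseteq> Y"
      using comp.hyps globular_boundary_subset by blast+
    show ?thesis
    proof (cases "?t \<in> X")
      case True
      then have "?y \<in> X" using globular_cell_closed[OF comp.hyps(1) _ yt] by blast
      then show ?thesis using True IH no BY 3 by auto
    next
      case False
      then have t: "?t \<in> Y" using comp.prems(2) by blast
      then have "?y \<in> Y" using globular_cell_closed[OF comp.hyps(2) _ yt] by blast
      then show ?thesis using t IH no AX 3 by auto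
    qed
  qed
qed

lemma collapse_onto_simplex:
  fixes z :: "nat set"
  assumes "finite z" "card z = Suc k"
  shows "\<exists>f. mono f \<and> f ` z = {..k} \<and> range f \<subseteq> {..k}"
proof (intro exI conjI)
  \<comment> \<open>Each vertex goes to the index of the last entry of \<open>z\<close> not above
    it; the truncated subtraction sends vertices below \<open>Min z\<close> to 0 as well.\<close>
  let ?f = "\<lambda>v. entry_position z v - 1"
  have le: "entry_position z v \<le> Suc k" for v
    unfolding entry_position_def assms(2)[symmetric] using assms(1) by (intro card_mono) auto
  show "mono ?f"
    unfolding entry_position_def using assms(1) by (intro monoI diff_le_mono card_mono) auto
  show range: "range ?f \<subseteq> {..k}"
    using le by (auto simp: diff_le_self le_diff_conv)
  have "inj_on ?f z"
  proof (rule linorder_inj_onI')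
    fix u v assume "u \<in> z" "v \<in> z" "u < v"
    then have "{w \<in> z. w \<le> u} \<subseteq> {w \<in> z. w \<le> v}" "v \<in> {w \<in> z. w \<le> v}"
        "v \<notin> {w \<in> z. w \<le> u}" "u \<in> {w \<in> z. w \<le> u}"
      by auto
    then have "{w \<in> z. w \<le> u} \<subset> {w \<in> z. w \<le> v}" "u \<in> {w \<in> z. w \<le> u}"
      by blast+
    then have "entry_position z u < entry_position z v" "entry_position z u \<noteq> 0"
      using assms(1) by (auto simp: entry_position_def intro!: psubset_card_mono)
    then show "?f u \<noteq> ?f v" by linarith
  qed
  then have "card (?f ` z) = card {..k}"
    using assms(2) by (simp add: card_image)
  then show "?f ` z = {..k}"
    using range by (intro card_subset_eq) auto
qed

lemma simplex_map_mem: "y \<in> X \<Longrightarrow> f ` y \<in> simplex_map f X"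
  by (simp add: simplex_map_def)

lemma simplex_map_range: "range f \<subseteq> V \<Longrightarrow> \<Union>(simplex_map f X) \<subseteq> V"
  by (auto simp: simplex_map_def)

text \<open>A common face of dimension greater than r would have a subface of dimension r + 1; collapsing
  the whole simplex onto that subface reduces the claim to globular_boundary_top.\<close>

lemma globular_comp_disjoint:
  "globular_cell X A \<Longrightarrow> globular_cell Y B \<Longrightarrow> A False r = B True r \<Longrightarrow> z \<in> X \<Longrightarrow> z \<in> Y
     \<Longrightarrow> card z \<le> Suc r"
proof (induction r arbitrary: X A Y B z rule: less_induct)
  case (less r)
  show ?case
  proof (rule ccontr)
    assume "\<not> card z \<le> Suc r"
    then obtain z' where z': "z' \<subseteq> z" "card z' = Suc (Suc r)"
      using obtain_subset_with_card_n[of "Suc (Suc r)" z] by auto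
    then have "finite z'" "z' \<noteq> {}" by (auto intro: card_ge_0_finite)
    then obtain f where f: "mono f" "f ` z' = {..Suc r}" "range f \<subseteq> {..Suc r}"
      using collapse_onto_simplex[of z' "Suc r"] z'(2) by auto
    have mem: "{..Suc r} \<in> simplex_map f X" "{..Suc r} \<in> simplex_map f Y"
      using less.prems z' \<open>z' \<noteq> {}\<close> globular_cell_closed simplex_map_mem f(2) by metis+
    have top: "{1..Suc r} \<in> C True r \<and> {1..Suc r} \<notin> C False r"
      if "globular_cell Z C" "\<Union>Z \<subseteq> {..Suc r}" "{..Suc r} \<in> Z" for Z C
      by (rule globular_boundary_top[OF _ that], rule less.IH)
    have "{1..Suc r} \<notin> simplex_map f (A False r)" "{1..Suc r} \<in> simplex_map f (B True r)"
      using top[OF globular_cell_simplex_map[OF f(1) less.prems(1)] simplex_map_range[OF f(3)] mem(1)]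
            top[OF globular_cell_simplex_map[OF f(1) less.prems(2)] simplex_map_range[OF f(3)] mem(2)]
      by blast+
    then show False using less.prems(3) by simp
  qed
qed

text \<open>Two such faces in different factors of a composite along \<open>r < p\<close> would map
  to a common face of dimension \<open>p\<close> of the image cells, against
  \<open>globular_comp_disjoint\<close>; in an atom only \<open>x\<close> itself has enough
  vertices. In effect a cell of dimension \<open>p\<close> projects to the \<open>p\<close>-simplex
  with degree at most one.\<close>

lemma globular_fibre_unique:
  assumes f: "mono f"
  shows "globular_cell X B \<Longrightarrow> (\<And>y. y \<in> X \<Longrightarrow> card y \<le> Suc p) \<Longrightarrow> y1 \<in> X \<Longrightarrow> y2 \<in> X \<Longrightarrow>
    f ` y1 = {..p} \<Longrightarrow> f ` y2 = {..p} \<Longrightarrow> y1 = y2"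
proof (induction arbitrary: y1 y2 rule: globular_cell.induct)
  case (vertex v)
  then show ?case by (simp add: subfaces_singleton)
next
  case (atom x p' C)
  have "y = x" if "y \<in> subfaces x" "f ` y = {..p}" for y
  proof -
    have "finite y" "y \<subseteq> x" "x \<noteq> {}"
      using that atom.hyps by (auto simp: mem_subfaces finite_subset)
    then have "Suc p \<le> card y" using card_image_le[of y f] that by simp
    moreover have "card x \<le> Suc p" using atom.prems(1) \<open>x \<noteq> {}\<close> by (simp add: mem_subfaces)
    ultimately show ?thesis
      using \<open>y \<subseteq> x\<close> atom.hyps(1) by (meson card_seteq le_trans)
  qed
  then show ?case using atom.prems by blast
next
  case (comp X A Y B r)
  show ?case
  proof (cases "p \<le> r")
    case True
    have "card y \<le> Suc r" if "y \<in> X \<union> Y" for y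
      using comp.prems(1)[OF that] True by simp
    then have "A False r = X" "B True r = Y"
      by (intro globular_boundary_eq comp.hyps; simp)+
    then show ?thesis using comp by simp
  next
    case False
    have "\<not> (y \<in> X \<and> f ` y = {..p} \<and> y' \<in> Y \<and> f ` y' = {..p})" for y y'
      using globular_comp_disjoint[OF globular_cell_simplex_map[OF f comp.hyps(1)]
              globular_cell_simplex_map[OF f comp.hyps(2)], of r "{..p}"]
            simplex_map_mem[of y X f] simplex_map_mem[of y' Y f] comp.hyps(3) False by auto
    then show ?thesis
      using comp.IH comp.prems by (metis UnE UnI1 UnI2)
  qed
qed

section \<open>Sources and targets are determined by the cell\<close>

text \<open>Boundary data for a \<open>q\<close>-source or \<open>q\<close>-target \<open>Z\<close>
  of a cell with data \<open>B\<close>: below \<open>q\<close> the globular identities pass on those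
  of \<open>B\<close>, and from \<open>q\<close> on \<open>Z\<close> is its own source and
  target.\<close>

definition truncate_boundary ::
  "nat \<Rightarrow> nat set set \<Rightarrow> (bool \<Rightarrow> nat \<Rightarrow> nat set set) \<Rightarrow> bool \<Rightarrow> nat \<Rightarrow> nat set set" where
  "truncate_boundary q Z B = (\<lambda>e r. if r < q then B e r else Z)"

text \<open>For an atom with \<open>q <= p\<close> the cell is a boundary of its source or target,
  and these agree below \<open>p\<close> by the last premise of \<open>atom\<close>. For a composite
  along \<open>p\<close> it is the composite of the \<open>q\<close>-boundaries if
  \<open>p < q\<close>, and otherwise a boundary of one factor.\<close>

lemma globular_cell_boundary:
  "globular_cell X B \<Longrightarrow> globular_cell (B e q) (truncate_boundary q (B e q) B)"
proof (induction arbitrary: e q rule: globular_cell.induct)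
  case (vertex v)
  then show ?case
    using globular_cell.vertex[of v] by (simp add: truncate_boundary_def)
next
  case (atom x p C)
  let ?B = "\<lambda>e q. if q < p then C e e q else if q = p then subfaces_of (oriented_faces e x) else subfaces x"
  have agree: "C c d r = C d d r" if "r < p" for c d r
    using atom.hyps(4)[OF that] by (cases c; cases d) auto
  consider "q < p" | "q = p" | "p < q" by linarith
  then show ?case
  proof cases
    case 1
    have "truncate_boundary q (?B e q) ?B = truncate_boundary q (C e e q) (C e)"
    proof (intro ext)
      fix d r
      show "truncate_boundary q (?B e q) ?B d r = truncate_boundary q (C e e q) (C e) d r"
        using agree[of r e d] 1 by (simp add: truncate_boundary_def)
    qed
    then show ?thesis
      using atom.IH[of e e q] 1 by simp
  next
    case 2
    have top: "C e d r = subfaces_of (oriented_faces e x)" if "p \<le> r" for d r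
      by (rule globular_boundary_eq[OF atom.hyps(3)])
        (use card_subfaces_of_oriented_faces[OF atom.hyps(1)] atom.hyps(2) that in fastforce)
    have "truncate_boundary q (?B e q) ?B = C e"
    proof (intro ext)
      fix d r
      show "truncate_boundary q (?B e q) ?B d r = C e d r"
        using agree[of r e d] top[of r d] 2 by (simp add: truncate_boundary_def)
    qed
    then show ?thesis
      using atom.hyps(3)[of e] 2 by simp
  next
    case 3
    then have "truncate_boundary q (?B e q) ?B = ?B"
      by (auto simp: truncate_boundary_def fun_eq_iff)
    then show ?thesis
      using globular_cell.atom[OF atom.hyps] 3 by simp
  qed
next
  case (comp X A Y B p)
  let ?D = "\<lambda>e q. if p < q then A e q \<union> B e q else if e then A e q else B e q"
  show ?case
  proof (cases "p < q")
    case True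
    have "globular_cell (A e q \<union> B e q)
      (\<lambda>d r. if p < r then truncate_boundary q (A e q) A d r \<union> truncate_boundary q (B e q) B d r
        else if d then truncate_boundary q (A e q) A d r else truncate_boundary q (B e q) B d r)"
      by (rule globular_cell.comp[OF comp.IH]) (use comp.hyps True in \<open>auto simp: truncate_boundary_def\<close>)
    moreover have "(\<lambda>d r. if p < r then truncate_boundary q (A e q) A d r \<union> truncate_boundary q (B e q) B d r
        else if d then truncate_boundary q (A e q) A d r else truncate_boundary q (B e q) B d r)
      = truncate_boundary q (?D e q) ?D"
      using True by (auto simp: truncate_boundary_def fun_eq_iff)
    ultimately show ?thesis
      using True by simp
  next
    case False
    have eq: "truncate_boundary q Z ?D = truncate_boundary q Z A"
         "truncate_boundary q Z ?D = truncate_boundary q Z B" for Z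
      using False comp.hyps(4) by (auto simp: truncate_boundary_def fun_eq_iff)
    show ?thesis
    proof (cases e)
      case True
      then show ?thesis unfolding eq(1) using comp.IH(1)[of True q] False by simp
    next
      case f: False
      then show ?thesis unfolding eq(2) using comp.IH(2)[of False q] False by simp
    qed
  qed
qed

lemma globular_boundary_mono:
  assumes "globular_cell X B" "q < r \<or> q = r \<and> c = e"
  shows "B e q \<subseteq> B c r"
  using globular_boundary_subset[OF globular_cell_boundary[OF assms(1), of c r], of e q] assms(2)
  by (auto simp: truncate_boundary_def)

text \<open>A potential on the faces that \<open>f\<close> maps bijectively onto
  \<open>{..p}\<close>. Passing through a coface from a face of orientation \<open>e\<close> to one
  of the opposite orientation exchanges an entry for another with the same image, and the parity of
  that image decides whether the entry grows or shrinks. The sign turns both cases into an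
  increase.\<close>

definition fibre_height :: "bool \<Rightarrow> (nat \<Rightarrow> nat) \<Rightarrow> nat set \<Rightarrow> int" where
  "fibre_height e f y = (\<Sum>u\<in>y. if odd (f u) = e then int u else - int u)"

lemma fibre_height_not: "fibre_height (\<not> e) f y = - fibre_height e f y"
  unfolding fibre_height_def sum_negf[symmetric] by (rule sum.cong) auto

text \<open>If y is a face of w on which f is bijective, then f identifies the vertex v missing from y with
  exactly one vertex u of y; these are neighbours in w, hence the face without u has the opposite
  orientation.\<close>

lemma opposite_face_in_fibre:
  assumes f: "mono f" "range f \<subseteq> {..p}" and w: "finite w" and y: "y \<in> oriented_faces e w"
    and fy: "f ` y = {..p}" "card y = Suc p"
  shows "\<exists>z. z \<in> oriented_faces (\<not> e) w \<and> f ` z = {..p} \<and> card z = Suc p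
    \<and> fibre_height e f y < fibre_height e f z"
proof -
  obtain v where v: "v \<notin> y" "w = insert v y" "odd (entry_position w v) = e"
    using y by (auto simp: oriented_faces_iff)
  have fin: "finite y" using w v(2) by simp
  have inj: "inj_on f y"
    using fy fin by (intro eq_card_imp_inj_on) auto
  have "f v \<in> f ` y" using f(2) fy(1) by blast
  then obtain u where u: "u \<in> y" "f u = f v" by auto
  have uv: "u \<noteq> v" using u v by auto
  \<comment> \<open>As \<open>f\<close> is bijective from \<open>y\<close> onto
    \<open>{..p}\<close>, \<open>L\<close> has \<open>f v\<close> elements, and these precede both
    \<open>u\<close> and \<open>v\<close> in \<open>w\<close>. The positions of \<open>u\<close> and
    \<open>v\<close> are therefore \<open>f v + 1\<close> and \<open>f v + 2\<close> in some
    order.\<close>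
  define L where "L = {t \<in> y. f t < f v}"
  have fv: "f v \<le> p" using f(2) by auto
  have "f ` L = {r \<in> f ` y. r < f v}"
    by (auto simp: L_def)
  also have "\<dots> = {..<f v}"
    using fv by (auto simp: fy(1))
  finally have "f ` L = {..<f v}" .
  moreover have "inj_on f L"
    using inj by (rule inj_on_subset) (auto simp: L_def)
  ultimately have cardL: "card L = f v"
    by (metis card_image card_lessThan)
  have finL: "finite L" using fin by (simp add: L_def)
  have L: "t < u" "t < v" if "t \<in> L" for t
    using that f(1) u(2) by (auto simp: L_def) (metis monoD not_le)+
  have notL: "u \<notin> L" "v \<notin> L" using u by (auto simp: L_def)
  have ge: "u \<le> t \<and> v < t" if "t \<in> y" "t \<notin> L" "t \<noteq> u" for t
  proof -
    have "f t \<noteq> f u" using inj that u(1) by (auto simp: inj_on_def)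
    then have "f u < f t" "f v < f t" using that u(2) by (auto simp: L_def)
    then show ?thesis using f(1) by (metis monoD not_le less_imp_le_nat)
  qed
  have "{t \<in> w. t \<le> v} = insert v (L \<union> (if u < v then {u} else {}))"
       "{t \<in> w. t \<le> u} = insert u (L \<union> (if v < u then {v} else {}))"
    using v(2) u uv L ge by (auto simp: L_def split: if_splits) (metis not_le le_antisym less_imp_le_nat)+
  then have pos: "entry_position w v = Suc (f v + (if u < v then 1 else 0))"
       "entry_position w u = Suc (f v + (if v < u then 1 else 0))"
    using finL notL uv cardL by (auto simp: entry_position_def card_insert_if)
  define z where "z = w - {u}"
  have zi: "z = insert v (y - {u})" using v u uv by (auto simp: z_def)
  have "odd (entry_position w u) = (\<not> e)"
    using pos v(3) uv by (auto split: if_splits)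
  then have "z \<in> oriented_faces (\<not> e) w"
    using u v(2) by (auto simp: z_def oriented_faces_def)
  moreover have "f ` z = {..p}"
  proof -
    have "f ` z = f ` insert u (y - {u})"
      by (simp only: zi image_insert u(2))
    also have "insert u (y - {u}) = y"
      using u(1) by blast
    finally show ?thesis using fy(1) by simp
  qed
  moreover have "card z = Suc p"
    using fy(2) u(1) v(1) fin by (simp add: zi card_insert_if)
  moreover have "fibre_height e f y < fibre_height e f z"
  proof -
    have "fibre_height e f y = (if odd (f u) = e then int u else - int u) + fibre_height e f (y - {u})"
      unfolding fibre_height_def using fin u(1) by (rule sum.remove)
    moreover have "fibre_height e f z = (if odd (f v) = e then int v else - int v) + fibre_height e f (y - {u})"
      unfolding fibre_height_def zi using fin v(1) by simp
    ultimately show ?thesis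
      using v(3) pos(1) uv u(2) by (auto split: if_splits)
  qed
  ultimately show ?thesis by blast
qed

text \<open>Among the faces of the fibre at least as high as \<open>y\<close>, take one of maximal
  height. If it were an \<open>e\<close>-face of some \<open>w\<close>, the opposite face of
  \<open>w\<close> in the fibre would be higher. The criterion is a hypothesis, \<open>bdry\<close>,
  because the lemma is applied inside the induction that proves it.\<close>

lemma fibre_reaches_boundary:
  assumes cell: "globular_cell X B" and f: "mono f" "range f \<subseteq> {..p}"
    and bdry: "\<And>y. card y = Suc p \<Longrightarrow> y \<in> B (\<not> e) p \<longleftrightarrow> y \<in> X \<and> (\<forall>w\<in>X. y \<notin> oriented_faces e w)"
    and y: "y \<in> X" "card y = Suc p" "f ` y = {..p}"
  shows "\<exists>z\<in>B (\<not> e) p. f ` z = {..p} \<and> fibre_height e f y \<le> fibre_height e f z"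
proof -
  define F where "F = {z \<in> X. card z = Suc p \<and> f ` z = {..p} \<and> fibre_height e f y \<le> fibre_height e f z}"
  have "finite F" "F \<noteq> {}"
    using globular_cell_finite[OF cell] y by (auto simp: F_def)
  then have "Max (fibre_height e f ` F) \<in> fibre_height e f ` F"
    by (intro Max_in) auto
  then obtain z where z: "z \<in> F" "fibre_height e f z = Max (fibre_height e f ` F)"
    by auto
  have max: "fibre_height e f t \<le> fibre_height e f z" if "t \<in> F" for t
    unfolding z(2) using \<open>finite F\<close> that by simp
  have "z \<notin> oriented_faces e w" if w: "w \<in> X" for w
  proof
    assume zw: "z \<in> oriented_faces e w"
    have zF: "f ` z = {..p}" "card z = Suc p" using z(1) by (auto simp: F_def)
    have "finite w" using globular_cell_face[OF cell w] by blast
    then obtain t where t: "t \<in> oriented_faces (\<not> e) w" "f ` t = {..p}" "card t = Suc p"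
        "fibre_height e f z < fibre_height e f t"
      using opposite_face_in_fibre[OF f \<open>finite w\<close> zw zF] by (elim exE conjE) (rule that)
    then have "t \<noteq> {}" by auto
    then have "t \<in> X"
      by (rule globular_cell_closed[OF cell w oriented_faces_subset[OF t(1)]])
    then have "t \<in> F" using t z(1) by (auto simp: F_def)
    then show False using max t(4) by force
  qed
  then show ?thesis
    using z(1) bdry[of z] by (auto simp: F_def)
qed

text \<open>The right-hand side mentions only the set of faces; this is what makes boundaries
  independent of the construction. Atoms are covered by \<open>no_oriented_face_iff\<close>. For
  composites along \<open>p\<close> and \<open>q > p\<close>, a face of dimension \<open>q\<close>
  lies in only one factor, together with all its cofaces. The case \<open>q = p\<close> needs the
  acyclicity argument \<open>core\<close>.\<close>

lemma globular_boundary_iff: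
  "globular_cell X B \<Longrightarrow> card y = Suc q \<Longrightarrow>
     y \<in> B e q \<longleftrightarrow> y \<in> X \<and> (\<forall>w\<in>X. y \<notin> oriented_faces (\<not> e) w)"
proof (induction arbitrary: e q y rule: globular_cell.induct)
  case (vertex v)
  then show ?case
    using card_oriented_faces[of "{v}" y] by (auto simp: subfaces_singleton)
next
  case (atom x p C)
  have sub: "y \<subseteq> x \<Longrightarrow> y \<in> subfaces x" using atom.prems by (auto simp: mem_subfaces)
  have le: "card w \<le> Suc (Suc p)" if "w \<in> subfaces x" for w
    using that atom.hyps(1,2) card_mono[of x w] by (simp add: mem_subfaces)
  have top: "w = x" if "w \<in> subfaces x" "Suc (Suc p) \<le> card w" for w
    using that atom.hyps(1,2) by (simp add: mem_subfaces card_seteq)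
  have face: "Suc (card y) = card w" if "w \<in> subfaces x" "y \<in> oriented_faces c w" for c w
    using that card_oriented_faces[of w y c] finite_subset[OF _ atom.hyps(1), of w] by (simp add: mem_subfaces)
  consider "q < p" | "q = p" | "p < q" by linarith
  then show ?case
  proof cases
    case 1
    have "y \<in> C e e q \<longleftrightarrow> y \<in> subfaces_of (oriented_faces e x) \<and>
        (\<forall>w\<in>subfaces_of (oriented_faces e x). y \<notin> oriented_faces (\<not> e) w)"
      by (rule atom.IH) (rule atom.prems)
    also have "\<dots> \<longleftrightarrow> y \<in> subfaces x \<and> (\<forall>w\<in>subfaces x. y \<notin> oriented_faces (\<not> e) w)"
    proof (cases "y \<subseteq> x")
      case True
      then show ?thesis
        using no_oriented_face_iff[of x y e "\<not> e"] atom.hyps(1,2) atom.prems 1 sub by force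
    qed (simp add: mem_subfaces mem_subfaces_of_oriented_faces)
    finally show ?thesis using 1 by simp
  next
    case 2
    have "y \<in> subfaces_of (oriented_faces e x) \<longleftrightarrow> y \<in> oriented_faces e x"
    proof
      assume "y \<in> subfaces_of (oriented_faces e x)"
      then obtain t where t: "t \<in> oriented_faces e x" "y \<subseteq> t"
        by (auto simp: mem_subfaces_of)
      have "finite t"
        by (rule finite_subset[OF oriented_faces_subset[OF t(1)] atom.hyps(1)])
      moreover have "card t = card y"
        using card_oriented_faces[OF atom.hyps(1) t(1)] atom.hyps(2) atom.prems 2 by simp
      ultimately show "y \<in> oriented_faces e x"
        using t card_subset_eq[of t y] by simp
    next
      assume "y \<in> oriented_faces e x"
      then show "y \<in> subfaces_of (oriented_faces e x)"
        using atom.prems by (auto simp: mem_subfaces_of)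
    qed
    also have "\<dots> \<longleftrightarrow> y \<in> subfaces x \<and> y \<notin> oriented_faces (\<not> e) x"
    proof (cases "y \<subseteq> x")
      case True
      have "card (x - y) = 1"
        using True atom.hyps(1,2) atom.prems 2 by (simp add: card_Diff_subset finite_subset)
      then obtain v where v: "x - y = {v}" by (auto simp: card_1_singleton_iff)
      then have only: "y = x - {u} \<and> u \<in> x \<and> P \<longleftrightarrow> u = v \<and> P" for u P using True by blast
      have "y \<in> oriented_faces c x \<longleftrightarrow> odd (entry_position x v) = c" for c
        unfolding oriented_faces_def mem_Collect_eq only by simp
      then show ?thesis using sub[OF True] by (cases e) simp_all
    next
      case False
      then show ?thesis using oriented_faces_subset by (auto simp: mem_subfaces)
    qed
    also have "\<dots> \<longleftrightarrow> y \<in> subfaces x \<and> (\<forall>w\<in>subfaces x. y \<notin> oriented_faces (\<not> e) w)"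
    proof -
      have "x \<in> subfaces x" using atom.hyps(2) by (auto simp: mem_subfaces)
      moreover have "w = x" if "w \<in> subfaces x" "y \<in> oriented_faces (\<not> e) w" for w
        using face[OF that] top[OF that(1)] atom.prems 2 by simp
      ultimately show ?thesis by blast
    qed
    finally show ?thesis using 2 by simp
  next
    case 3
    have "y \<notin> oriented_faces (\<not> e) w" if w: "w \<in> subfaces x" for w
      using face[OF w, of "\<not> e"] le[OF w] atom.prems 3 by fastforce
    then show ?thesis using 3 by auto
  qed
next
  case (comp X A Y B p)
  note IHX = comp.IH(1) and IHY = comp.IH(2)
  have both: "y \<in> X \<Longrightarrow> y \<in> Y \<Longrightarrow> q \<le> p"
    using globular_comp_disjoint[OF comp.hyps(1,2,3)] comp.prems by fastforce
  have faceX: "w \<in> X \<Longrightarrow> y \<in> oriented_faces c w \<Longrightarrow> y \<in> X" for w c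
    using globular_cell_closed[OF comp.hyps(1) _ oriented_faces_subset] comp.prems by fastforce
  have faceY: "w \<in> Y \<Longrightarrow> y \<in> oriented_faces c w \<Longrightarrow> y \<in> Y" for w c
    using globular_cell_closed[OF comp.hyps(2) _ oriented_faces_subset] comp.prems by fastforce
  have AX: "A c r \<subseteq> X" and BY: "B c r \<subseteq> Y" for c r
    using comp.hyps globular_boundary_subset by blast+
  consider "q < p" | "q = p" | "p < q" by linarith
  then show ?case
  proof cases
    case 1
    then have "A e q = B e q" by (rule comp.hyps(4))
    moreover note IHX[OF comp.prems, of e] IHY[OF comp.prems, of e]
    ultimately have "y \<in> A e q \<longleftrightarrow> y \<in> X \<union> Y \<and> (\<forall>w\<in>X \<union> Y. y \<notin> oriented_faces (\<not> e) w)"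
      by (metis UnE UnI1 UnI2)
    then show ?thesis using 1 \<open>A e q = B e q\<close> by (cases e) simp_all
  next
    case 3
    then show ?thesis
      using IHX[OF comp.prems, of e] IHY[OF comp.prems, of e] both faceX[of _ "\<not> e"] faceY[of _ "\<not> e"]
      by simp (metis UnE UnI1 UnI2 not_le)
  next
    case 2
    \<comment> \<open>Collapse everything onto \<open>y\<close>. Moves through cofaces in
      \<open>X\<close> lead from \<open>y\<close> to a higher face \<open>t\<close> of
      \<open>A False p\<close>; the reverse moves in \<open>Y\<close> lead to a lower face
      \<open>t'\<close> of \<open>B True p\<close>. The two boundaries coincide and contain only one
      face of the fibre, so \<open>t = t'\<close>, which is absurd.\<close>
    have core: False if w: "w \<in> X" "y \<in> oriented_faces True w" "w' \<in> Y" "y \<in> oriented_faces False w'" for w w'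
    proof -
      have card: "card y = Suc p" using comp.prems 2 by simp
      then have "finite y" by (auto intro: card_ge_0_finite)
      then obtain f where f: "mono f" "range f \<subseteq> {..p}" "f ` y = {..p}"
        using collapse_onto_simplex card by blast
      obtain z where z: "z \<in> oriented_faces False w" "f ` z = {..p}" "card z = Suc p"
          "fibre_height True f y < fibre_height True f z"
        using opposite_face_in_fibre[OF f(1,2) _ w(2) f(3) card] globular_cell_face[OF comp.hyps(1) w(1)] by fastforce
      obtain z' where z': "z' \<in> oriented_faces True w'" "f ` z' = {..p}" "card z' = Suc p"
          "fibre_height False f y < fibre_height False f z'"
        using opposite_face_in_fibre[OF f(1,2) _ w(4) f(3) card] globular_cell_face[OF comp.hyps(2) w(3)] by fastforce
      have "z \<in> X" "z' \<in> Y"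
        using globular_cell_closed[OF comp.hyps(1) w(1) oriented_faces_subset[OF z(1)]] z(3)
          globular_cell_closed[OF comp.hyps(2) w(3) oriented_faces_subset[OF z'(1)]] z'(3) by fastforce+
      obtain t where t: "t \<in> A False p" "f ` t = {..p}" "fibre_height True f z \<le> fibre_height True f t"
        using fibre_reaches_boundary[OF comp.hyps(1) f(1,2), of True z] IHX[of _ p False]
          \<open>z \<in> X\<close> z(2,3) by auto
      obtain t' where t': "t' \<in> B True p" "f ` t' = {..p}" "fibre_height False f z' \<le> fibre_height False f t'"
        using fibre_reaches_boundary[OF comp.hyps(2) f(1,2), of False z'] IHY[of _ p True]
          \<open>z' \<in> Y\<close> z'(2,3) by auto
      have "t = t'"
        by (rule globular_fibre_unique[OF f(1) globular_cell_boundary[OF comp.hyps(1), of False p]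
              globular_boundary_card[OF comp.hyps(1)]]) (use t t' comp.hyps(3) in auto)
      then show False
        using t(3) t'(3) z(4) z'(4) fibre_height_not[of True f] by simp
    qed
    note IH = IHX[OF comp.prems] IHY[OF comp.prems]
    show ?thesis
    proof (cases e)
      case True
      have "y \<in> A True q \<longleftrightarrow> y \<in> X \<union> Y \<and> (\<forall>w\<in>X \<union> Y. y \<notin> oriented_faces False w)"
      proof
        assume y: "y \<in> A True q"
        have "y \<notin> oriented_faces False w" if w: "w \<in> Y" for w
        proof
          assume yw: "y \<in> oriented_faces False w"
          then have "y \<notin> A False q"
            using IH(2)[of True] comp.hyps(3) 2 w by auto
          then show False
            using IH(1)[of False] AX y core[OF _ _ w yw] by auto
        qed
        then show "y \<in> X \<union> Y \<and> (\<forall>w\<in>X \<union> Y. y \<notin> oriented_faces False w)"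
          using y IH(1)[of True] by auto
      next
        assume y: "y \<in> X \<union> Y \<and> (\<forall>w\<in>X \<union> Y. y \<notin> oriented_faces False w)"
        then have "y \<in> Y \<Longrightarrow> y \<in> A False q"
          using IH(2)[of True] comp.hyps(3) 2 by auto
        then have "y \<in> X" using y AX by blast
        then show "y \<in> A True q"
          using y IH(1)[of True] by auto
      qed
      then show ?thesis using 2 True by simp
    next
      case False
      have "y \<in> B False q \<longleftrightarrow> y \<in> X \<union> Y \<and> (\<forall>w\<in>X \<union> Y. y \<notin> oriented_faces True w)"
      proof
        assume y: "y \<in> B False q"
        have "y \<notin> oriented_faces True w" if w: "w \<in> X" for w
        proof
          assume yw: "y \<in> oriented_faces True w"
          then have "y \<notin> B True q"
            using IH(1)[of False] comp.hyps(3) 2 w by auto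
          then show False
            using IH(2)[of True] BY y core[OF w yw] by auto
        qed
        then show "y \<in> X \<union> Y \<and> (\<forall>w\<in>X \<union> Y. y \<notin> oriented_faces True w)"
          using y IH(2)[of False] by auto
      next
        assume y: "y \<in> X \<union> Y \<and> (\<forall>w\<in>X \<union> Y. y \<notin> oriented_faces True w)"
        then have "y \<in> X \<Longrightarrow> y \<in> B True q"
          using IH(1)[of False] comp.hyps(3) 2 by auto
        then have "y \<in> Y" using y BY by blast
        then show "y \<in> B False q"
          using y IH(2)[of False] by auto
      qed
      then show ?thesis using 2 False by simp
    qed
  qed
qed

text \<open>The criterion describes only faces of dimension exactly \<open>q\<close>. This lemma
  supplies the rest: a boundary is rebuilt dimension by dimension from its faces of top dimension
  and the boundary below.\<close>

lemma globular_cell_covered: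
  "globular_cell X B \<Longrightarrow> (\<And>y. y \<in> X \<Longrightarrow> card y \<le> Suc (Suc q)) \<Longrightarrow> y \<in> X \<Longrightarrow>
     y \<in> B e q \<or> (\<exists>w\<in>X. card w = Suc (Suc q) \<and> y \<subseteq> w)"
proof (induction arbitrary: y e rule: globular_cell.induct)
  case (vertex v)
  then show ?case by simp
next
  case (atom x p C)
  have x: "x \<in> subfaces x" using atom.hyps(2) by (auto simp: mem_subfaces)
  then have "p \<le> q" using atom.prems(1)[of x] atom.hyps(2) by simp
  show ?case
  proof (cases "p = q")
    case True
    then show ?thesis using x atom.prems(2) atom.hyps(2) by (auto simp: mem_subfaces)
  next
    case False
    then show ?thesis using \<open>p \<le> q\<close> atom.prems(2) by simp
  qed
next
  case (comp X A Y B r)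
  have IHX: "y \<in> X \<Longrightarrow> y \<in> A e q \<or> (\<exists>w\<in>X \<union> Y. card w = Suc (Suc q) \<and> y \<subseteq> w)"
   and IHY: "y \<in> Y \<Longrightarrow> y \<in> B e q \<or> (\<exists>w\<in>X \<union> Y. card w = Suc (Suc q) \<and> y \<subseteq> w)" for y e
    using comp.IH[of y e] comp.prems(1) by (meson UnI1 UnI2)+
  consider "r < q" | "r = q" | "q < r" by linarith
  then show ?case
  proof cases
    case 1
    then show ?thesis using IHX[of y e] IHY[of y e] comp.prems(2) by auto
  next
    case 2
    \<comment> \<open>For \<open>e = True\<close>, a face of \<open>Y\<close> lying in the shared
      boundary is also a face of \<open>X\<close>, to which the claim for \<open>X\<close> applies;
      for \<open>e = False\<close> the roles are exchanged.\<close>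
    have "A False q \<subseteq> X" "B True q \<subseteq> Y"
      using comp.hyps globular_boundary_subset by blast+
    then show ?thesis
      using IHX[of y] IHY[of y] comp.prems(2) comp.hyps(3) 2 by (cases e; simp) blast+
  next
    case 3
    have le: "card y \<le> Suc r" if "y \<in> X \<union> Y" for y
      using comp.prems(1)[OF that] 3 by simp
    have "A False r = X" "B True r = Y"
      by (rule globular_boundary_eq; use comp.hyps le in simp)+
    then have "X = Y" using comp.hyps(3) by simp
    then show ?thesis
      using IHX[of y e] IHY[of y e] comp.prems(2) 3 by auto
  qed
qed

lemma globular_boundary_covered:
  assumes "globular_cell X B" "y \<in> B e (Suc q)"
  shows "y \<in> B e q \<or> (\<exists>w\<in>B e (Suc q). card w = Suc (Suc q) \<and> y \<subseteq> w)"
proof -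
  have "y \<in> truncate_boundary (Suc q) (B e (Suc q)) B e q \<or> (\<exists>w\<in>B e (Suc q). card w = Suc (Suc q) \<and> y \<subseteq> w)"
    by (rule globular_cell_covered[OF globular_cell_boundary[OF assms(1)]])
      (use globular_boundary_card[OF assms(1)] assms(2) in auto)
  then show ?thesis by (simp add: truncate_boundary_def)
qed

lemma globular_boundary_subsetI:
  assumes A: "globular_cell X A" and B: "globular_cell Y B"
    and sub: "\<And>j y. j \<le> q \<Longrightarrow> card y = Suc j \<Longrightarrow> y \<in> A e j \<Longrightarrow> y \<in> B e j"
  shows "A e q \<subseteq> B e q"
  using sub
proof (induction q)
  case 0
  show ?case
  proof
    fix y assume y: "y \<in> A e 0"
    then have "y \<in> X" using globular_boundary_subset[OF A] by blast
    then have "card y \<noteq> 0" using globular_cell_face[OF A] by auto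
    then have "card y = 1"
      using globular_boundary_card[OF A y] by linarith
    then show "y \<in> B e 0" using 0[of 0 y] y by simp
  qed
next
  case (Suc q)
  then have IH: "A e q \<subseteq> B e q" by simp
  have mono: "B e q \<subseteq> B e (Suc q)"
    by (rule globular_boundary_mono[OF B]) simp
  show ?case
  proof
    fix y assume y: "y \<in> A e (Suc q)"
    have "y \<in> X" using y globular_boundary_subset[OF A] by blast
    then have ne: "y \<noteq> {}" using globular_cell_face[OF A] by blast
    show "y \<in> B e (Suc q)"
    proof (cases "y \<in> A e q")
      case True
      then show ?thesis using IH mono by blast
    next
      case False
      then obtain w where w: "w \<in> A e (Suc q)" "card w = Suc (Suc q)" "y \<subseteq> w"
        using globular_boundary_covered[OF A y] by blast
      then have "w \<in> B e (Suc q)" using Suc.prems[of "Suc q" w] by simp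
      then show ?thesis
        using globular_cell_closed[OF globular_cell_boundary[OF B] _ w(3) ne] by blast
    qed
  qed
qed

section \<open>Independence of the construction, and comparison with
  \<open>simplex_cell\<close>\<close>

lemma globular_cell_unique:
  assumes "globular_cell X A" "globular_cell X B"
  shows "A = B"
proof (intro ext equalityI)
  fix e q
  show "A e q \<subseteq> B e q"
    by (rule globular_boundary_subsetI[OF assms])
      (use globular_boundary_iff[OF assms(1)] globular_boundary_iff[OF assms(2)] in blast)
  show "B e q \<subseteq> A e q"
    by (rule globular_boundary_subsetI[OF assms(2,1)])
      (use globular_boundary_iff[OF assms(1)] globular_boundary_iff[OF assms(2)] in blast)
qed

text \<open>The common \<open>p\<close>-boundary is itself a cell, and uniqueness fixes its lower
  boundaries. Hence the globular identities in the rule \<open>comp\<close> always hold.\<close>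

lemma globular_boundary_agree:
  assumes X: "globular_cell X A" and Y: "globular_cell Y B" and p: "A c p = B d p" and q: "q < p"
  shows "A e q = B e q"
proof -
  have "truncate_boundary p (A c p) A = truncate_boundary p (B d p) B"
    using globular_cell_unique[OF globular_cell_boundary[OF X, of c p]] globular_cell_boundary[OF Y, of d p] p
    by metis
  then have "truncate_boundary p (A c p) A e q = truncate_boundary p (B d p) B e q"
    by simp
  then show ?thesis
    using q by (simp add: truncate_boundary_def)
qed

text \<open>The globular identities come for free. For an atom, the lower boundaries of source and
  target satisfy the same criterion in \<open>subfaces x\<close> by
  \<open>no_oriented_face_iff\<close>; for a composite, \<open>globular_boundary_agree\<close>
  applies.\<close>

lemma globular_cell_if_simplex_cell:
  "simplex_cell n X S T \<Longrightarrow> globular_cell X (\<lambda>e. if e then S else T) \<and> \<Union>X \<subseteq> {..n}"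
proof (induction rule: simplex_cell.induct)
  case (vertex v)
  then show ?case
    using globular_cell.vertex[of v] by (simp add: subfaces_singleton)
next
  case (atom x p S S' T' T)
  have x: "finite x" "card x = Suc (Suc p)" "x \<subseteq> {..n}"
    using atom.hyps(1,2) finite_subset[of x "{..n}"] by (auto simp: simplex_face_def face_dim_def)
  define C where "C = (\<lambda>c e. if c then (if e then S else S') else (if e then T' else T))"
  have C: "globular_cell (subfaces_of (oriented_faces c x)) (C c)" for c
    using atom.IH by (cases c) (simp_all add: C_def oriented_faces_True oriented_faces_False)
  have iff: "y \<in> C c e j \<longleftrightarrow> y \<in> subfaces x \<and> (\<forall>w\<in>subfaces x. y \<notin> oriented_faces (\<not> e) w)"
    if "j < p" "card y = Suc j" for c e j y
  proof (cases "y \<subseteq> x")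
    case True
    have "y \<noteq> {}" using that(2) by auto
    then show ?thesis
      using globular_boundary_iff[OF C that(2), of c e] no_oriented_face_iff[OF x(1) True, of c "\<not> e"]
        that x(2) True by (simp add: mem_subfaces)
  next
    case False
    have "C c e j \<subseteq> subfaces x"
      using globular_boundary_subset[OF C] subfaces_of_oriented_faces_subset by (rule order_trans)
    then show ?thesis
      using False mem_subfaces by blast
  qed
  have sub: "C c e q \<subseteq> C d e q" if "q < p" for c d e q
    by (rule globular_boundary_subsetI[OF C C]) (use iff that in auto)
  have agree: "C True e q = C False e q" if "q < p" for q e
    using sub[OF that] by blast
  have "globular_cell (subfaces x)
     (\<lambda>e q. if q < p then C e e q else if q = p then subfaces_of (oriented_faces e x) else subfaces x)"
    by (rule globular_cell.atom[OF x(1,2) C agree])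
  moreover have "(\<lambda>e q. if q < p then C e e q else if q = p then subfaces_of (oriented_faces e x) else subfaces x)
    = (\<lambda>e. if e then (\<lambda>q. if q < p then S q else if q = p then subfaces_of (odd_faces x) else subfaces x)
       else (\<lambda>q. if q < p then T q else if q = p then subfaces_of (even_faces x) else subfaces x))"
    by (auto simp: fun_eq_iff C_def oriented_faces_True oriented_faces_False)
  moreover have "\<Union>(subfaces x) \<subseteq> {..n}"
    using x(3) unfolding subfaces_def by blast
  ultimately show ?case by simp
next
  case (comp X S T Y S' T' p)
  let ?A = "\<lambda>e. if e then S else T" and ?B = "\<lambda>e. if e then S' else T'"
  have XY: "globular_cell X ?A" "globular_cell Y ?B" using comp.IH by simp_all
  have p: "?A False p = ?B True p" using comp.hyps(3) by simp
  have "globular_cell (X \<union> Y) (\<lambda>e q. if p < q then ?A e q \<union> ?B e q else if e then ?A e q else ?B e q)"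
    by (rule globular_cell.comp[OF XY p]) (rule globular_boundary_agree[OF XY p])
  also have "(\<lambda>e q. if p < q then ?A e q \<union> ?B e q else if e then ?A e q else ?B e q)
    = (\<lambda>e. if e then (\<lambda>q. if q \<le> p then S q else S q \<union> S' q) else (\<lambda>q. if q \<le> p then T' q else T q \<union> T' q))"
    by (auto simp: fun_eq_iff)
  finally show ?case using comp.IH by simp
qed

lemma simplex_cell_if_globular_cell:
  "globular_cell X B \<Longrightarrow> \<Union>X \<subseteq> {..n} \<Longrightarrow> simplex_cell n X (B True) (B False)"
proof (induction rule: globular_cell.induct)
  case (vertex v)
  then show ?case using simplex_cell.vertex[of v n] by (simp add: subfaces_singleton)
next
  case (atom x p C)
  have "x \<in> subfaces x" using atom.hyps(2) by (auto simp: mem_subfaces)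
  then have "x \<subseteq> {..n}" using atom.prems by blast
  then have "simplex_face n x" using atom.hyps(2) by (auto simp: simplex_face_def)
  moreover have "face_dim x = Suc p" using atom.hyps(2) by (simp add: face_dim_def)
  moreover have "\<Union>(subfaces_of (oriented_faces c x)) \<subseteq> {..n}" for c
    using atom.prems subfaces_of_oriented_faces_subset[of c x] by blast
  moreover have "simplex_cell n (subfaces_of (odd_faces x)) (C True True) (C True False)"
    "simplex_cell n (subfaces_of (even_faces x)) (C False True) (C False False)"
    using atom.IH[of True] atom.IH[of False] calculation(3)[of True] calculation(3)[of False]
    by (simp_all add: oriented_faces_True oriented_faces_False)
  ultimately have "simplex_cell n (subfaces x)
      (\<lambda>q. if q < p then C True True q else if q = p then subfaces_of (odd_faces x) else subfaces x)
      (\<lambda>q. if q < p then C False False q else if q = p then subfaces_of (even_faces x) else subfaces x)"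
    by (intro simplex_cell.atom)
  then show ?case
    unfolding oriented_faces_True oriented_faces_False .
next
  case (comp X A Y B p)
  have "simplex_cell n (X \<union> Y) (\<lambda>q. if q \<le> p then A True q else A True q \<union> B True q)
      (\<lambda>q. if q \<le> p then B False q else A False q \<union> B False q)"
    by (rule simplex_cell.comp) (use comp in auto)
  moreover have "(\<lambda>q. if q \<le> p then A True q else A True q \<union> B True q)
      = (\<lambda>q. if p < q then A True q \<union> B True q else A True q)"
    "(\<lambda>q. if q \<le> p then B False q else A False q \<union> B False q)
      = (\<lambda>q. if p < q then A False q \<union> B False q else B False q)"
    by (auto simp: fun_eq_iff)
  ultimately show ?case by (simp cong: if_cong)
qed

section \<open>The simplex category in terms of \<open>globular_cell\<close>\<close>

lemma cells_simplex_cat_iff: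
  "X \<in> cells (simplex_cat n) \<longleftrightarrow> (\<exists>B. globular_cell X B) \<and> \<Union>X \<subseteq> {..n}"
proof
  assume "X \<in> cells (simplex_cat n)"
  then obtain S T where "simplex_cell n X S T" by (auto simp: simplex_cat_def)
  then show "(\<exists>B. globular_cell X B) \<and> \<Union>X \<subseteq> {..n}"
    using globular_cell_if_simplex_cell by blast
next
  assume "(\<exists>B. globular_cell X B) \<and> \<Union>X \<subseteq> {..n}"
  then obtain B where "globular_cell X B" "\<Union>X \<subseteq> {..n}" by blast
  then have "simplex_cell n X (B True) (B False)" by (rule simplex_cell_if_globular_cell)
  then show "X \<in> cells (simplex_cat n)" by (auto simp: simplex_cat_def)
qed

lemma simplex_cat_boundary:
  assumes "globular_cell X B" "\<Union>X \<subseteq> {..n}"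
  shows "src (simplex_cat n) q X = B True q" "tgt (simplex_cat n) q X = B False q"
proof -
  have cell: "simplex_cell n X (B True) (B False)"
    by (rule simplex_cell_if_globular_cell[OF assms])
  have unique: "S = B True \<and> T = B False" if "simplex_cell n X S T" for S T
    using globular_cell_unique[OF assms(1) conjunct1[OF globular_cell_if_simplex_cell[OF that]]] by simp
  show "src (simplex_cat n) q X = B True q" "tgt (simplex_cat n) q X = B False q"
    unfolding simplex_cat_def omega_cat.simps using cell unique by (blast intro!: the_equality)+
qed

lemma gcomp_simplex_cat: "gcomp (simplex_cat n) p X Y = X \<union> Y"
  by (simp add: simplex_cat_def)

text \<open>The source omits the entry in position 1, so an edge runs from its larger vertex to its
  smaller one; this is why the maximum is the source. By the criterion the extremal vertices lie in
  the boundaries, and \<open>globular_fibre_unique\<close> for a constant map leaves no room for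
  another vertex.\<close>

lemma globular_cell_extremal_vertices:
  assumes "globular_cell X B"
  shows "finite (\<Union>X)" "\<Union>X \<noteq> {}" "B True 0 = {{Max (\<Union>X)}}" "B False 0 = {{Min (\<Union>X)}}"
proof -
  note face = globular_cell_face[OF assms]
  show fin: "finite (\<Union>X)" and ne: "\<Union>X \<noteq> {}"
    using globular_cell_finite[OF assms] globular_cell_nonempty[OF assms] face by auto
  have single: "B e 0 = {{v}}" if v: "{v} \<in> B e 0" for e v
  proof -
    have "y = {v}" if y: "y \<in> B e 0" for y
    proof (rule globular_fibre_unique[OF _ globular_cell_boundary[OF assms] globular_boundary_card[OF assms] y])
      show "mono (\<lambda>_::nat. 0::nat)" by (simp add: mono_def)
      have "y \<in> X" using y globular_boundary_subset[OF assms] by blast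
      then show "(\<lambda>_. 0) ` y = {..0::nat}" using face by auto
    qed (use v in auto)
    then show ?thesis using v by blast
  qed
  have vertex: "{v} \<in> X" if "v \<in> \<Union>X" for v
    using that globular_cell_closed[OF assms] by auto
  show "B True 0 = {{Max (\<Union>X)}}"
  proof (rule single)
    have "{Max (\<Union>X)} \<notin> oriented_faces False w" if w: "w \<in> X" for w
    proof
      assume "{Max (\<Union>X)} \<in> oriented_faces False w"
      then obtain u where u: "u \<noteq> Max (\<Union>X)" "w = insert u {Max (\<Union>X)}" "even (entry_position w u)"
        by (auto simp: oriented_faces_iff)
      have "u \<le> Max (\<Union>X)" using fin w u(2) by (intro Max_ge) auto
      then have "{t \<in> w. t \<le> u} = {u}" using u(1,2) by auto
      then show False using u(3) by (simp add: entry_position_def)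
    qed
    then show "{Max (\<Union>X)} \<in> B True 0"
      using globular_boundary_iff[OF assms, of "{Max (\<Union>X)}" 0 True] vertex Max_in[OF fin ne] by auto
  qed
  show "B False 0 = {{Min (\<Union>X)}}"
  proof (rule single)
    have "{Min (\<Union>X)} \<notin> oriented_faces True w" if w: "w \<in> X" for w
    proof
      assume "{Min (\<Union>X)} \<in> oriented_faces True w"
      then obtain u where u: "u \<noteq> Min (\<Union>X)" "w = insert u {Min (\<Union>X)}" "odd (entry_position w u)"
        by (auto simp: oriented_faces_iff)
      have "Min (\<Union>X) \<le> u" using fin w u(2) by (intro Min_le) auto
      then have "{t \<in> w. t \<le> u} = {u, Min (\<Union>X)}" using u(1,2) by auto
      then show False using u(1,3) by (simp add: entry_position_def)
    qed
    then show "{Min (\<Union>X)} \<in> B False 0"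
      using globular_boundary_iff[OF assms, of "{Min (\<Union>X)}" 0 False] vertex Min_in[OF fin ne] by auto
  qed
qed

section \<open>Cones\<close>

text \<open>The apex \<open>a\<close> may already be a vertex of \<open>Y\<close>. This keeps the
  operation idempotent and lets it apply to cells whose 0-target is \<open>a\<close>.\<close>

definition cone :: "nat \<Rightarrow> nat set set \<Rightarrow> nat set set" where
  "cone a Y = insert {a} (Y \<union> insert a ` Y)"

lemma cone_mono: "X \<subseteq> Y \<Longrightarrow> cone a X \<subseteq> cone a Y"
  by (auto simp: cone_def)

lemma cone_Un: "cone a (X \<union> Y) = cone a X \<union> cone a Y"
  by (auto simp: cone_def)

lemma subset_cone: "Y \<subseteq> cone a Y"
  by (auto simp: cone_def)

lemma cone_cone: "cone a (cone a Y) = cone a Y"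
  by (auto simp: cone_def)

lemma cone_vertex: "cone a {{a}} = {{a}}"
  by (simp add: cone_def)

lemma Union_cone: "\<Union>(cone a Y) = insert a (\<Union>Y)"
  by (auto simp: cone_def)

lemma cone_subfaces:
  assumes "x \<noteq> {}"
  shows "cone a (subfaces x) = subfaces (insert a x)"
proof
  show "cone a (subfaces x) \<subseteq> subfaces (insert a x)"
    by (auto simp: cone_def mem_subfaces)
  show "subfaces (insert a x) \<subseteq> cone a (subfaces x)"
  proof
    fix z assume "z \<in> subfaces (insert a x)"
    then have z: "z \<noteq> {}" "z \<subseteq> insert a x" by (auto simp: mem_subfaces)
    show "z \<in> cone a (subfaces x)"
    proof (cases "a \<in> z")
      case True
      then have "z = insert a (z - {a})" by blast
      moreover have "z - {a} = {} \<or> z - {a} \<in> subfaces x" using z by (auto simp: mem_subfaces)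
      ultimately show ?thesis unfolding cone_def by blast
    next
      case False
      then show ?thesis using z by (auto simp: cone_def mem_subfaces)
    qed
  qed
qed

lemma entry_position_insert_least:
  assumes "finite x" "\<And>v. v \<in> x \<Longrightarrow> a < v"
  shows "entry_position (insert a x) a = 1"
    and "v \<in> x \<Longrightarrow> entry_position (insert a x) v = Suc (entry_position x v)"
proof -
  have "{u \<in> insert a x. u \<le> a} = {a}"
    using assms(2) by force
  then show "entry_position (insert a x) a = 1"
    by (simp add: entry_position_def)
  assume v: "v \<in> x"
  have "{u \<in> insert a x. u \<le> v} = insert a {u \<in> x. u \<le> v}"
    using assms(2)[OF v] by auto
  moreover have "a \<notin> {u \<in> x. u \<le> v}"
    using assms(2) by auto
  ultimately show "entry_position (insert a x) v = Suc (entry_position x v)"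
    using assms(1) by (simp add: entry_position_def)
qed

text \<open>The new vertex takes position 1 and contributes the face \<open>x\<close> to the source;
  all other positions grow by one, which exchanges odd and even.\<close>

lemma oriented_faces_insert_least:
  assumes "finite x" "\<And>v. v \<in> x \<Longrightarrow> a < v"
  shows "oriented_faces True (insert a x) = insert x (insert a ` oriented_faces False x)"
    and "oriented_faces False (insert a x) = insert a ` oriented_faces True x"
proof -
  have ax: "a \<notin> x" using assms(2) by blast
  note pos = entry_position_insert_least[OF assms]
  have faces: "oriented_faces e y = (\<lambda>v. y - {v}) ` {v \<in> y. odd (entry_position y v) = e}" for e y
    by (auto simp: oriented_faces_def)
  have "{v \<in> insert a x. odd (entry_position (insert a x) v) = True} = insert a {v \<in> x. odd (entry_position x v) = False}"
    "{v \<in> insert a x. odd (entry_position (insert a x) v) = False} = {v \<in> x. odd (entry_position x v) = True}"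
    using pos ax by auto
  moreover have "insert a x - {v} = insert a (x - {v})" if "v \<in> x" for v
    using that ax by auto
  moreover have "insert a x - {a} = x" using ax by auto
  ultimately show "oriented_faces True (insert a x) = insert x (insert a ` oriented_faces False x)"
    "oriented_faces False (insert a x) = insert a ` oriented_faces True x"
    unfolding faces by (simp_all add: image_image)
qed

lemma oriented_faces_True_nonempty:
  assumes "finite x" "x \<noteq> {}"
  shows "oriented_faces True x \<noteq> {}"
proof -
  have "{u \<in> x. u \<le> Min x} = {Min x}"
    using assms Min_in[OF assms] Min_le[OF assms(1)] by (blast intro: antisym)
  then have "odd (entry_position x (Min x)) = True"
    by (simp add: entry_position_def)
  then have "x - {Min x} \<in> oriented_faces True x"
    unfolding oriented_faces_def using Min_in[OF assms] by blast
  then show ?thesis by blast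
qed

lemma oriented_faces_False_nonempty:
  assumes "finite x" "card x = Suc (Suc p)"
  shows "oriented_faces False x \<noteq> {}"
proof -
  define y where "y = x - {Min x}"
  have "x \<noteq> {}" using assms(2) by auto
  then have min: "Min x \<in> x" "\<And>v. v \<in> x \<Longrightarrow> Min x \<le> v" using assms(1) by simp_all
  then have "card y = Suc p" using assms by (simp add: y_def)
  then have "y \<noteq> {}" by auto
  moreover have "finite y" "\<And>v. v \<in> y \<Longrightarrow> Min x < v" "x = insert (Min x) y"
    using assms(1) min by (auto simp: y_def le_neq_trans)
  ultimately show ?thesis
    using oriented_faces_insert_least(2)[of y "Min x"] oriented_faces_True_nonempty[of y] by auto
qed

text \<open>For empty \<open>F\<close> the right-hand side would still contain the apex. Hence the
  preceding lemmas on nonemptiness, and the demand for two entries where even faces are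
  coned.\<close>

lemma subfaces_of_insert:
  assumes "F \<noteq> {}"
  shows "subfaces_of (insert a ` F) = cone a (subfaces_of F)"
proof -
  have "subfaces (insert a y) = insert {a} (subfaces y \<union> insert a ` subfaces y)" for y
    using cone_subfaces[of y a] by (cases "y = {}") (auto simp: cone_def subfaces_def)
  then show ?thesis
    using assms by (auto simp: subfaces_of_def cone_def)
qed

lemma subfaces_of_oriented_faces_insert_least:
  assumes "finite x" "x \<noteq> {}" "\<And>v. v \<in> x \<Longrightarrow> a < v"
  shows "subfaces_of (oriented_faces False (insert a x)) = cone a (subfaces_of (oriented_faces True x))"
    and "card x = Suc (Suc p) \<Longrightarrow>
      subfaces_of (oriented_faces True (insert a x)) = subfaces x \<union> cone a (subfaces_of (oriented_faces False x))"
proof -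
  show "subfaces_of (oriented_faces False (insert a x)) = cone a (subfaces_of (oriented_faces True x))"
    using subfaces_of_insert[OF oriented_faces_True_nonempty[OF assms(1,2)]]
    by (simp add: oriented_faces_insert_least(2)[OF assms(1,3)])
  assume "card x = Suc (Suc p)"
  note F = oriented_faces_False_nonempty[OF assms(1) this]
  have "subfaces_of (insert x G) = subfaces x \<union> subfaces_of G" for G
    by (auto simp: subfaces_of_def)
  then show "subfaces_of (oriented_faces True (insert a x)) = subfaces x \<union> cone a (subfaces_of (oriented_faces False x))"
    by (simp add: oriented_faces_insert_least(1)[OF assms(1,3)] subfaces_of_insert[OF F])
qed

lemma oriented_faces_edge:
  assumes "a < v"
  shows "subfaces_of (oriented_faces True {a, v}) = subfaces {v}"
    and "subfaces_of (oriented_faces False {a, v}) = subfaces {a}"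
proof -
  have "{u \<in> {v}. u \<le> v} = {v}" by auto
  then have "entry_position {v} v = 1" by (simp add: entry_position_def)
  then have "oriented_faces False {v} = {}" "oriented_faces True {v} = {{}}"
    by (auto simp: oriented_faces_def)
  then have "oriented_faces True {a, v} = {{v}}" "oriented_faces False {a, v} = {{a}}"
    using oriented_faces_insert_least[of "{v}" a] assms by auto
  then show "subfaces_of (oriented_faces True {a, v}) = subfaces {v}"
      "subfaces_of (oriented_faces False {a, v}) = subfaces {a}"
    by (simp_all add: subfaces_of_def)
qed

text \<open>Coning raises dimension by one, hence the shift. In dimension 0 there is nothing to cone
  over: this part of the source is empty, and \<open>cone_boundary\<close> takes the apex as
  target.\<close>

definition tgt_cone :: "nat \<Rightarrow> (bool \<Rightarrow> nat \<Rightarrow> nat set set) \<Rightarrow> nat \<Rightarrow> nat set set" where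
  "tgt_cone a B q = (case q of 0 \<Rightarrow> {} | Suc r \<Rightarrow> cone a (B False r))"

definition cone_boundary ::
  "nat \<Rightarrow> (bool \<Rightarrow> nat \<Rightarrow> nat set set) \<Rightarrow> bool \<Rightarrow> nat \<Rightarrow> nat set set" where
  "cone_boundary a B e q =
     (if e then B True q \<union> tgt_cone a B q else (case q of 0 \<Rightarrow> {{a}} | Suc r \<Rightarrow> cone a (B True r)))"

lemma tgt_cone_simps [simp]:
  "tgt_cone a B 0 = {}" "tgt_cone a B (Suc r) = cone a (B False r)"
  by (simp_all add: tgt_cone_def)

lemma cone_boundary_simps [simp]:
  "cone_boundary a B True q = B True q \<union> tgt_cone a B q"
  "cone_boundary a B False 0 = {{a}}" "cone_boundary a B False (Suc r) = cone a (B True r)"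
  by (simp_all add: cone_boundary_def)

lemma tgt_cone_mono:
  assumes "globular_cell X B" "q \<le> r"
  shows "tgt_cone a B q \<subseteq> tgt_cone a B r"
proof (cases q)
  case (Suc i)
  then obtain j where j: "r = Suc j" "i \<le> j" using assms(2) by (cases r) auto
  then show ?thesis
    using Suc globular_boundary_mono[OF assms(1), of i j False False]
    by (simp add: cone_mono le_eq_less_or_eq)
qed simp

lemma tgt_cone_cong: "(\<And>r. r < q \<Longrightarrow> A False r = B False r) \<Longrightarrow> tgt_cone a A q = tgt_cone a B q"
  by (cases q) auto

text \<open>Used for an atom that already contains the apex: it is itself a cone, and coning it
  again must not change its boundaries.\<close>

lemma cone_boundary_idem:
  assumes "globular_cell X B"
  shows "cone_boundary a (cone_boundary a B) = cone_boundary a B"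
proof (intro ext)
  fix e q
  have mono: "cone a (B c i) \<subseteq> cone a (B d j)" if "i < j" for c d i j
    using globular_boundary_mono[OF assms] that by (intro cone_mono) auto
  show "cone_boundary a (cone_boundary a B) e q = cone_boundary a B e q"
  proof (cases q)
    case 0
    then show ?thesis by (cases e) simp_all
  next
    case (Suc r)
    show ?thesis
    proof (cases r)
      case 0
      have "{{a}} \<subseteq> cone a Z" for Z by (auto simp: cone_def)
      then show ?thesis using Suc 0 by (cases e) (auto simp: cone_vertex)
    next
      case (Suc s)
      then show ?thesis
        using \<open>q = Suc r\<close> mono[of s "Suc s" True False] mono[of s "Suc s" False True]
        by (cases e) (auto simp: cone_Un cone_cone)
    qed
  qed
qed

text \<open>The cones over the targets \<open>B False j\<close> are attached for increasing
  \<open>j\<close>. The \<open>j\<close>-source of such a cone is \<open>B False j\<close> with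
  \<open>tgt_cone a B j\<close>, exactly the \<open>j\<close>-target of what has been built so far,
  so the two compose along \<open>j\<close>. The result has the shape of the source of a
  cone.\<close>

lemma globular_cell_whiskered:
  assumes cell: "globular_cell X B"
    and cones: "\<And>j. j < p \<Longrightarrow>
      globular_cell (cone a (B False j)) (cone_boundary a (truncate_boundary j (B False j) B))"
  shows "globular_cell (X \<union> tgt_cone a B p)
     (\<lambda>e q. if e then B True q \<union> tgt_cone a B (min q p)
            else if q < p then cone_boundary a B False q else B False q \<union> tgt_cone a B p)"
  using cones
proof (induction p)
  case 0
  have "(\<lambda>e q. if e then B True q \<union> tgt_cone a B (min q 0)
      else if q < 0 then cone_boundary a B False q else B False q \<union> tgt_cone a B 0) = B"
    by (auto simp: fun_eq_iff)
  then show ?case using cell by simp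
next
  case (Suc j)
  let ?W = "\<lambda>p e q. if e then B True q \<union> tgt_cone a B (min q p)
            else if q < p then cone_boundary a B False q else B False q \<union> tgt_cone a B p"
  let ?K = "cone_boundary a (truncate_boundary j (B False j) B)"
  have W: "globular_cell (X \<union> tgt_cone a B j) (?W j)" using Suc by simp
  have K: "globular_cell (cone a (B False j)) ?K" using Suc.prems by simp
  have tc: "tgt_cone a (truncate_boundary j (B False j) B) q = tgt_cone a B q" if "q \<le> j" for q
    by (rule tgt_cone_cong) (use that in \<open>simp add: truncate_boundary_def\<close>)
  have match: "?W j False j = ?K True j"
    by (simp add: tc) (simp add: truncate_boundary_def)
  have "globular_cell (X \<union> tgt_cone a B j \<union> cone a (B False j))
     (\<lambda>e q. if j < q then ?W j e q \<union> ?K e q else if e then ?W j e q else ?K e q)"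
    by (rule globular_cell.comp[OF W K match]) (rule globular_boundary_agree[OF W K match])
  moreover have "X \<union> tgt_cone a B j \<union> cone a (B False j) = X \<union> tgt_cone a B (Suc j)"
    using tgt_cone_mono[OF cell, of j "Suc j" a] by auto
  moreover have "(\<lambda>e q. if j < q then ?W j e q \<union> ?K e q else if e then ?W j e q else ?K e q) = ?W (Suc j)"
  proof (intro ext)
    fix e q
    show "(if j < q then ?W j e q \<union> ?K e q else if e then ?W j e q else ?K e q) = ?W (Suc j) e q"
    proof (cases "j < q")
      case True
      then obtain r where r: "q = Suc r" "j \<le> r" by (cases q) auto
      then have "?K e q = cone a (B False j)"
        using subset_cone[of "B False j" a] by (cases e) (auto simp: truncate_boundary_def)
      then show ?thesis
        using True tgt_cone_mono[OF cell, of j "Suc j" a] by (cases e) auto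
    next
      case False
      then have "?K False q = cone_boundary a B False q"
        by (cases q) (auto simp: truncate_boundary_def)
      then show ?thesis
        using False by (cases e) (auto simp: min_def)
    qed
  qed
  ultimately show ?case by simp
qed

lemma tgt_cone_truncate:
  "q \<le> p \<Longrightarrow> tgt_cone a (truncate_boundary p Z B) q = tgt_cone a B q"
  by (rule tgt_cone_cong) (simp add: truncate_boundary_def)

lemma cone_boundary_False_truncate:
  "q \<le> p \<Longrightarrow> cone_boundary a (truncate_boundary p Z B) False q = cone_boundary a B False q"
  by (cases q) (simp_all add: truncate_boundary_def)

text \<open>The cone over a composite X *_p Y is (W *_p cone Y) *_(p + 1) cone X, where W is the
  (p + 1)-source of X whiskered with the cones over the targets of X of dimension less than p.\<close>

lemma globular_cell_cone_comp:
  assumes X: "globular_cell X A" and Y: "globular_cell Y B" and p: "A False p = B True p"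
    and cones: "\<And>j. j < p \<Longrightarrow>
      globular_cell (cone a (A False j)) (cone_boundary a (truncate_boundary j (A False j) A))"
    and coneX: "globular_cell (cone a X) (cone_boundary a A)"
    and coneY: "globular_cell (cone a Y) (cone_boundary a B)"
  shows "globular_cell (cone a (X \<union> Y))
    (cone_boundary a (\<lambda>e q. if p < q then A e q \<union> B e q else if e then A e q else B e q))"
proof -
  let ?Z = "A True (Suc p)"
  define A' where "A' = truncate_boundary (Suc p) ?Z A"
  have A': "globular_cell ?Z A'"
    unfolding A'_def by (rule globular_cell_boundary[OF X])
  have A'_eq: "A' e q = (if q \<le> p then A e q else ?Z)" for e q
    by (auto simp: A'_def truncate_boundary_def)
  have tcA': "tgt_cone a A' q = tgt_cone a A q" if "q \<le> Suc p" for q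
    unfolding A'_def using that by (rule tgt_cone_truncate)
  have agree: "A e q = B e q" if "q < p" for e q
    using that by (rule globular_boundary_agree[OF X Y p])
  have tcB: "tgt_cone a A q = tgt_cone a B q" if "q \<le> p" for q
    by (rule tgt_cone_cong) (use agree that in simp)
  define W where "W = (\<lambda>e q. if e then A' True q \<union> tgt_cone a A' (min q p)
            else if q < p then cone_boundary a A' False q else A' False q \<union> tgt_cone a A' p)"
  have W: "globular_cell (?Z \<union> tgt_cone a A p) W"
  proof -
    have "globular_cell (?Z \<union> tgt_cone a A' p) W"
      unfolding W_def
    proof (rule globular_cell_whiskered[OF A'])
      fix j assume j: "j < p"
      have "truncate_boundary j (A False j) A' = truncate_boundary j (A False j) A"
        using j by (auto simp: truncate_boundary_def A'_eq fun_eq_iff)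
      then show "globular_cell (cone a (A' False j)) (cone_boundary a (truncate_boundary j (A' False j) A'))"
        using cones[OF j] j by (simp add: A'_eq)
    qed
    then show ?thesis by (simp add: tcA')
  qed
  \<comment> \<open>Whiskering has added to \<open>A False p\<close> precisely the cone that the
    \<open>p\<close>-source of \<open>cone a Y\<close> carries beside
    \<open>B True p\<close>.\<close>
  have pW: "W False p = cone_boundary a B True p"
    by (simp add: W_def A'_eq tcA' tcB p)
  define M where "M = (\<lambda>e q. if p < q then W e q \<union> cone_boundary a B e q
      else if e then W e q else cone_boundary a B e q)"
  have M: "globular_cell (?Z \<union> tgt_cone a A p \<union> cone a Y) M"
    unfolding M_def by (rule globular_cell.comp[OF W coneY pW]) (rule globular_boundary_agree[OF W coneY pW])
  have tcp: "tgt_cone a A p \<subseteq> cone a (A e r)" if "p \<le> r" for e r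
  proof (cases p)
    case (Suc i)
    then show ?thesis
      using that globular_boundary_mono[OF X, of i r e False] by (simp add: cone_mono)
  qed simp
  \<comment> \<open>The \<open>(p + 1)\<close>-target of the first composite contains the cone over
    \<open>B True p\<close>, that is over \<open>A False p\<close>. This absorbs
    \<open>tgt_cone a A p\<close> and leaves the \<open>(p + 1)\<close>-source of
    \<open>cone a X\<close>.\<close>
  have pM: "M False (Suc p) = cone_boundary a A True (Suc p)"
    using tcp[of p False] by (auto simp: M_def W_def A'_eq tcA' p[symmetric])
  define N where "N = (\<lambda>e q. if Suc p < q then M e q \<union> cone_boundary a A e q
      else if e then M e q else cone_boundary a A e q)"
  have N: "globular_cell (?Z \<union> tgt_cone a A p \<union> cone a Y \<union> cone a X) N"
    unfolding N_def by (rule globular_cell.comp[OF M coneX pM]) (rule globular_boundary_agree[OF M coneX pM])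
  have "?Z \<union> tgt_cone a A p \<union> cone a Y \<union> cone a X = cone a (X \<union> Y)"
  proof -
    have "A False p \<subseteq> X" "?Z \<subseteq> X" using globular_boundary_subset[OF X] by blast+
    then have "tgt_cone a A p \<subseteq> cone a X" "?Z \<subseteq> cone a X"
      using tcp[of p False] cone_mono[of "A False p" X a] subset_cone[of X a] by auto
    then show ?thesis by (auto simp: cone_Un)
  qed
  moreover have "N = cone_boundary a (\<lambda>e q. if p < q then A e q \<union> B e q else if e then A e q else B e q)"
    (is "N = cone_boundary a ?D")
  proof (intro ext)
    fix e q
    have tcD: "tgt_cone a ?D q = tgt_cone a A q" if "q \<le> p" for q
      by (rule tgt_cone_cong) (use agree that in auto)
    consider "q \<le> p" | "q = Suc p" | r where "q = Suc r" "p < r"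
      by (cases q) (auto, linarith)
    then show "N e q = cone_boundary a ?D e q"
    proof cases
      case 1
      show ?thesis
      proof (cases e)
        case True
        then show ?thesis
          using 1 by (simp add: N_def M_def W_def A'_eq tcA' tcD)
      next
        case False
        have "cone_boundary a A False q = cone_boundary a ?D False q"
          using 1 agree by (cases q) simp_all
        then show ?thesis
          using 1 False by (simp add: N_def)
      qed
    next
      case 2
      have "tgt_cone a A p \<subseteq> cone a (B False p)"
        using tcB[of p] globular_boundary_mono[OF Y] by (cases p) (simp_all add: cone_mono)
      then show ?thesis
        using 2 by (cases e) (auto simp: N_def M_def W_def A'_eq tcA')
    next
      case (3 r)
      have "?Z \<subseteq> A True q" "?Z \<subseteq> A True r"
        using 3 globular_boundary_mono[OF X, of "Suc p" q True True]
          globular_boundary_mono[OF X, of "Suc p" r True True] by (auto dest: Suc_lessI)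
      moreover have "A True r \<subseteq> cone a (A True r)" by (rule subset_cone)
      moreover note tcp[of r True] tcp[of r False]
      ultimately show ?thesis
        using 3 by (cases e) (auto simp: N_def M_def W_def A'_eq tcA' cone_Un)
    qed
  qed
  ultimately show ?thesis using N by simp
qed

text \<open>The cone is the atom of \<open>insert a x\<close>, whose source and target must first be
  shown to be cells. The target is the cone over the source of \<open>x\<close>; the source is
  \<open>x\<close> whiskered with the cones over its targets up to dimension \<open>p\<close>. Both
  use only cones over boundaries of \<open>x\<close>.\<close>

lemma globular_cell_cone_atom:
  assumes x: "finite x" "card x = Suc (Suc p)" "\<And>v. v \<in> x \<Longrightarrow> a < v"
    and cell: "globular_cell (subfaces x) B"
    and B: "\<And>e. B e p = subfaces_of (oriented_faces e x)" "\<And>e q. p < q \<Longrightarrow> B e q = subfaces x"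
    and cones: "\<And>e j. j \<le> p \<Longrightarrow>
      globular_cell (cone a (B e j)) (cone_boundary a (truncate_boundary j (B e j) B))"
  shows "globular_cell (cone a (subfaces x)) (cone_boundary a B)"
proof -
  let ?y = "insert a x"
  have ne: "x \<noteq> {}" using x(2) by auto
  have y: "finite ?y" "card ?y = Suc (Suc (Suc p))"
    using x(1,2) x(3)[of a] by (auto simp: card_insert_if)
  note faces = subfaces_of_oriented_faces_insert_least[OF x(1) ne x(3)]
  have odd: "subfaces_of (oriented_faces True ?y) = subfaces x \<union> tgt_cone a B (Suc p)"
    using faces(2)[OF _ x(2)] by (simp add: B(1))
  have even: "subfaces_of (oriented_faces False ?y) = cone a (B True p)"
    using faces(1) by (simp add: B(1))
  define C where "C = (\<lambda>c. if c
    then (\<lambda>e q. if e then B True q \<union> tgt_cone a B (min q (Suc p))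
            else if q < Suc p then cone_boundary a B False q else B False q \<union> tgt_cone a B (Suc p))
    else cone_boundary a (truncate_boundary p (B True p) B))"
  have "globular_cell (subfaces_of (oriented_faces True ?y)) (C True)"
    unfolding odd C_def if_True by (rule globular_cell_whiskered[OF cell]) (use cones in simp)
  moreover have "globular_cell (subfaces_of (oriented_faces False ?y)) (C False)"
    unfolding even C_def if_False by (rule cones) simp
  ultimately have C: "globular_cell (subfaces_of (oriented_faces c ?y)) (C c)" for c
    by (cases c) simp_all
  have CF: "C False e q = cone_boundary a B e q" and CT: "C True e q = cone_boundary a B e q" if "q \<le> p" for e q
  proof -
    have "truncate_boundary p (B True p) B True q = B True q"
      using that by (auto simp: truncate_boundary_def)
    then show "C False e q = cone_boundary a B e q"
      using that by (cases e) (simp_all add: C_def tgt_cone_truncate cone_boundary_False_truncate)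
    show "C True e q = cone_boundary a B e q"
      using that by (cases e) (simp_all add: C_def)
  qed
  have "globular_cell (subfaces ?y) (\<lambda>e q. if q < Suc p then C e e q
      else if q = Suc p then subfaces_of (oriented_faces e ?y) else subfaces ?y)"
    by (rule globular_cell.atom[OF y C]) (simp add: CF CT)
  moreover have "(\<lambda>e q. if q < Suc p then C e e q
      else if q = Suc p then subfaces_of (oriented_faces e ?y) else subfaces ?y) = cone_boundary a B"
  proof (intro ext)
    fix e q
    consider "q \<le> p" | "q = Suc p" | r where "q = Suc r" "p < r"
      by (cases q) (auto, linarith)
    then show "(if q < Suc p then C e e q
      else if q = Suc p then subfaces_of (oriented_faces e ?y) else subfaces ?y) = cone_boundary a B e q"
    proof cases
      case 1
      then show ?thesis by (cases e) (simp_all add: CF CT)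
    next
      case 2
      then show ?thesis by (cases e) (simp_all add: odd even B(2))
    next
      case (3 r)
      then show ?thesis
        using subset_cone[of "subfaces x" a] by (cases e) (auto simp: B(2) cone_subfaces[OF ne])
    qed
  qed
  ultimately show ?thesis
    by (simp add: cone_subfaces[OF ne])
qed

lemma globular_cell_cone_vertex:
  assumes "a \<le> v"
  shows "globular_cell (cone a (subfaces {v})) (cone_boundary a (\<lambda>e q. subfaces {v}))"
proof (cases "a = v")
  case True
  have "cone_boundary a (\<lambda>e q. subfaces {a}) e q = subfaces {a}" for e q
    by (cases e; cases q) (simp_all add: subfaces_singleton cone_vertex)
  then have "cone_boundary a (\<lambda>e q. subfaces {a}) = (\<lambda>e q. subfaces {a})"
    by (simp add: fun_eq_iff)
  then show ?thesis
    using True globular_cell.vertex[of a] by (simp add: cone_subfaces)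
next
  case False
  let ?x = "insert a {v}"
  have "a < v" using assms False by simp
  note faces = oriented_faces_edge[OF this]
  define C where "C = (\<lambda>c (e :: bool) (q :: nat). subfaces_of (oriented_faces c ?x))"
  have C: "globular_cell (subfaces_of (oriented_faces c ?x)) (C c)" for c
    using globular_cell.vertex by (cases c) (simp_all add: C_def faces)
  have "globular_cell (subfaces ?x) (\<lambda>e q. if q < 0 then C e e q
      else if q = 0 then subfaces_of (oriented_faces e ?x) else subfaces ?x)"
    by (rule globular_cell.atom[OF _ _ C]) (use False in auto)
  moreover have "(\<lambda>e q. if q < 0 then C e e q
      else if q = 0 then subfaces_of (oriented_faces e ?x) else subfaces ?x)
      = cone_boundary a (\<lambda>e q. subfaces {v})"
  proof (intro ext)
    fix e q
    show "(if q < 0 then C e e q else if q = 0 then subfaces_of (oriented_faces e ?x) else subfaces ?x)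
      = cone_boundary a (\<lambda>e q. subfaces {v}) e q"
      using subset_cone[of "subfaces {v}" a]
      by (cases e; cases q) (auto simp: faces subfaces_singleton cone_subfaces[of "{v}", unfolded subfaces_singleton])
  qed
  ultimately show ?thesis by (simp add: cone_subfaces)
qed

text \<open>An atom is the cone from its least vertex over the opposite face. The bound
  \<open>d\<close> on the available cones allows use within the induction that proves the cone
  theorem; the theorem itself then yields all atoms.\<close>

lemma globular_cell_subfaces_if_cones:
  assumes cones: "\<And>c z B. globular_cell (subfaces z) B \<Longrightarrow> finite z \<Longrightarrow> card z < d \<Longrightarrow>
      (\<And>v. v \<in> z \<Longrightarrow> c \<le> v) \<Longrightarrow> globular_cell (cone c (subfaces z)) (cone_boundary c B)"
  shows "finite x \<Longrightarrow> x \<noteq> {} \<Longrightarrow> card x \<le> d \<Longrightarrow> \<exists>B. globular_cell (subfaces x) B"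
proof (induction "card x" arbitrary: x)
  case 0
  then show ?case by simp
next
  case (Suc k)
  define c z where "c = Min x" and "z = x - {c}"
  have c: "c \<in> x" "\<And>v. v \<in> x \<Longrightarrow> c \<le> v" using Suc.prems by (simp_all add: c_def)
  show ?case
  proof (cases "z = {}")
    case True
    then have "x = {c}" using c by (auto simp: z_def)
    then show ?thesis using globular_cell.vertex[of c] by auto
  next
    case False
    have z: "finite z" "card z = k" "x = insert c z" using Suc.hyps(2) Suc.prems c by (auto simp: z_def)
    then have "card z < d" using Suc.hyps(2) Suc.prems(3) by simp
    moreover obtain B where "globular_cell (subfaces z) B"
      using Suc.hyps(1)[of z] z False \<open>card z < d\<close> by auto
    ultimately have "globular_cell (cone c (subfaces z)) (cone_boundary c B)"
      using cones[of z B c] z(1,3) c(2) by blast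
    then show ?thesis using z(3) cone_subfaces[OF False] by auto
  qed
qed

text \<open>Two nested inductions: the outer one, on the bound \<open>d\<close>, provides cones over
  boundaries and over smaller faces; the inner one, on the construction of the cell, provides cones
  over the factors of a composite, which need not have smaller dimension.\<close>

lemma globular_cell_cone_bounded:
  "globular_cell X B \<Longrightarrow> (\<And>y. y \<in> X \<Longrightarrow> card y \<le> d) \<Longrightarrow> (\<And>v. v \<in> \<Union>X \<Longrightarrow> a \<le> v) \<Longrightarrow>
     globular_cell (cone a X) (cone_boundary a B)"
proof (induction d arbitrary: a X B rule: less_induct)
  case (less d)
  have boundary: "globular_cell (cone a (B e j)) (cone_boundary a (truncate_boundary j (B e j) B))"
    if "globular_cell X B" "\<And>v. v \<in> \<Union>X \<Longrightarrow> a \<le> v" "Suc j < d" for a X B e j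
    by (rule less.IH[OF that(3) globular_cell_boundary[OF that(1)] globular_boundary_card[OF that(1)]])
      (use that(2) globular_boundary_subset[OF that(1), of e j] in auto)
  have face: "\<exists>B. globular_cell (subfaces y) B" if y: "finite y" "y \<noteq> {}" "card y < d" for y
  proof (rule globular_cell_subfaces_if_cones[OF _ y(1,2) order_refl])
    fix c z B
    assume z: "globular_cell (subfaces z) B" "finite z" "card z < card y" "\<And>v. v \<in> z \<Longrightarrow> c \<le> v"
    show "globular_cell (cone c (subfaces z)) (cone_boundary c B)"
    proof (rule less.IH[OF _ z(1)])
      show "card z < d" using z(3) y(3) by simp
      show "card t \<le> card z" if "t \<in> subfaces z" for t
        using that z(2) by (simp add: mem_subfaces card_mono)
      show "c \<le> v" if "v \<in> \<Union>(subfaces z)" for v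
        using that z(4) unfolding subfaces_def by blast
    qed
  qed
  show ?case
    using less.prems
  proof (induction rule: globular_cell.induct)
    case (vertex v)
    then show ?case by (intro globular_cell_cone_vertex) (simp add: subfaces_singleton)
  next
    case (atom x p C)
    let ?B = "\<lambda>e q. if q < p then C e e q else if q = p then subfaces_of (oriented_faces e x) else subfaces x"
    have cell: "globular_cell (subfaces x) ?B"
      by (rule globular_cell.atom) (use atom.hyps in auto)
    have x: "x \<in> subfaces x" using atom.hyps(2) by (auto simp: mem_subfaces)
    then have d: "Suc p < d" using atom.prems(1)[of x] atom.hyps(2) by simp
    have ax: "a \<le> v" if "v \<in> x" for v using x that atom.prems(2) by blast
    show ?case
    proof (cases "a \<in> x")
      case False
      show ?thesis
      proof (rule globular_cell_cone_atom[OF atom.hyps(1,2) _ cell])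
        show "a < v" if "v \<in> x" for v using ax[OF that] False that by (auto simp: le_less)
        show "globular_cell (cone a (?B e j)) (cone_boundary a (truncate_boundary j (?B e j) ?B))" if "j \<le> p" for e j
          by (rule boundary[OF cell]) (use atom.prems(2) d that in auto)
      qed simp_all
    next
      case True
      \<comment> \<open>Here \<open>x\<close> is itself the cone over \<open>y\<close>. Uniqueness
        identifies its boundary data with those of that cone, and coning is idempotent.\<close>
      define y where "y = x - {a}"
      have y: "finite y" "y \<noteq> {}" "card y < d" "x = insert a y" "\<And>v. v \<in> y \<Longrightarrow> a \<le> v"
      proof -
        have "card y = Suc p" using atom.hyps(1,2) True by (simp add: y_def)
        then show "y \<noteq> {}" "card y < d" using d by auto
      qed (use atom.hyps(1) True ax in \<open>auto simp: y_def\<close>)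
      obtain B where B: "globular_cell (subfaces y) B" using face y by blast
      have "globular_cell (cone a (subfaces y)) (cone_boundary a B)"
      proof (rule less.IH[OF y(3) B])
        show "card t \<le> card y" if "t \<in> subfaces y" for t
          using that y(1) by (simp add: mem_subfaces card_mono)
      qed (use y(5) subfaces_def in blast)
      then have conex: "globular_cell (subfaces x) (cone_boundary a B)"
        using cone_subfaces[OF y(2)] y(4) by simp
      then have "?B = cone_boundary a B"
        by (rule globular_cell_unique[OF cell])
      moreover have "cone a (subfaces x) = subfaces x"
        using cone_subfaces[of x a] True atom.hyps(2) by (force simp: insert_absorb)
      ultimately show ?thesis
        using conex cone_boundary_idem[OF B] by simp
    qed
  next
    case (comp X A Y B p)
    have coneX: "globular_cell (cone a X) (cone_boundary a A)"
      using comp.IH(1) comp.prems by blast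
    have coneY: "globular_cell (cone a Y) (cone_boundary a B)"
      using comp.IH(2) comp.prems by blast
    show ?case
    proof (cases "Suc p < d")
      case True
      show ?thesis
        by (rule globular_cell_cone_comp[OF comp.hyps(1,2,3) _ coneX coneY])
          (rule boundary[OF comp.hyps(1)], use comp.prems(2) True in auto)
    next
      case False
      \<comment> \<open>No face exceeds the dimension of the composition, so the composite is
        trivial.\<close>
      have le: "card y \<le> Suc p" if "y \<in> X \<union> Y" for y
        using comp.prems(1)[OF that] False by simp
      have "A False p = X" "B True p = Y"
        by (rule globular_boundary_eq; use comp.hyps le in simp)+
      then have XY: "X = Y" using comp.hyps(3) by simp
      then have "A = B" using globular_cell_unique comp.hyps(1,2) by blast
      then have "(\<lambda>e q. if p < q then A e q \<union> B e q else if e then A e q else B e q) = A"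
        by (auto simp: fun_eq_iff)
      then show ?thesis using XY coneX by simp
    qed
  qed
qed

theorem globular_cell_cone:
  assumes "globular_cell X B" "\<And>v. v \<in> \<Union>X \<Longrightarrow> a \<le> v"
  shows "globular_cell (cone a X) (cone_boundary a B)"
proof (rule globular_cell_cone_bounded[OF assms(1) _ assms(2)])
  show "card y \<le> Max (card ` X)" if "y \<in> X" for y
    using that globular_cell_finite[OF assms(1)] by simp
qed

lemma globular_cell_subfaces:
  assumes "finite x" "x \<noteq> {}"
  shows "\<exists>B. globular_cell (subfaces x) B"
  by (rule globular_cell_subfaces_if_cones[OF globular_cell_cone assms order_refl])
    (use subfaces_def in blast)+


section \<open>Functors out of a simplex\<close>

text \<open>By uniqueness \<open>B\<close> must be the data of the cone from \<open>Min x\<close>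
  over the remaining face, however the cell was derived; induction on \<open>p\<close> then reads
  off the boundary.\<close>

lemma globular_cell_subfaces_boundary:
  "globular_cell (subfaces x) B \<Longrightarrow> finite x \<Longrightarrow> card x = Suc (Suc p)
     \<Longrightarrow> B e p = subfaces_of (oriented_faces e x)"
proof (induction p arbitrary: x B e)
  case (Suc p x B e)
  define a y where "a = Min x" and "y = x - {a}"
  have ne: "x \<noteq> {}" using Suc.prems(3) by auto
  then have "a \<in> x" "\<And>v. v \<in> x \<Longrightarrow> a \<le> v" using Suc.prems(2) by (simp_all add: a_def)
  then have y: "finite y" "card y = Suc (Suc p)" "x = insert a y" "\<And>v. v \<in> y \<Longrightarrow> a < v"
    using Suc.prems(2,3) by (auto simp: y_def le_neq_trans)
  then have yne: "y \<noteq> {}" by auto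
  obtain C where C: "globular_cell (subfaces y) C"
    using globular_cell_subfaces[OF y(1) yne] by blast
  have "globular_cell (cone a (subfaces y)) (cone_boundary a C)"
    by (rule globular_cell_cone[OF C]) (use y(4) subfaces_def less_imp_le in blast)
  then have B: "B = cone_boundary a C"
    using globular_cell_unique[OF Suc.prems(1)] by (simp add: cone_subfaces[OF yne] y(3))
  have "C True (Suc p) = subfaces y"
    by (rule globular_boundary_eq[OF C]) (use y(1,2) card_mono[OF y(1)] in \<open>simp add: mem_subfaces\<close>)
  then show ?case
    using subfaces_of_oriented_faces_insert_least[OF y(1) yne y(4)] y(2,3) Suc.IH[OF C y(1,2)]
    by (cases e) (simp_all add: B)
next
  case (0 x B e)
  define a y where "a = Min x" and "y = x - {a}"
  have ne: "x \<noteq> {}" using 0 by auto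
  then have a: "a \<in> x" "\<And>v. v \<in> x \<Longrightarrow> a \<le> v" using 0 by (simp_all add: a_def)
  then have "card y = 1" using 0 by (simp add: y_def)
  then obtain v where "x - {a} = {v}" by (auto simp: y_def card_1_singleton_iff)
  then have v: "x = {a, v}" "v \<in> x" "a \<noteq> v"
    using a(1) by blast+
  then have x: "x = {a, v}" "a < v"
    using a(2)[OF v(2)] by simp_all
  have "globular_cell (cone a (subfaces {v})) (cone_boundary a (\<lambda>e q. subfaces {v}))"
    using x(2) by (intro globular_cell_cone_vertex) simp
  then have "B = cone_boundary a (\<lambda>e q. subfaces {v})"
    using globular_cell_unique[OF 0(1)] by (simp add: cone_subfaces x(1))
  then show ?case
    using oriented_faces_edge[OF x(2)] by (cases e) (simp_all add: x(1) subfaces_singleton)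
qed

section \<open>Positive-dimensional cells and functors into the path category\<close>

lemma globular_cell_boundary_eventually: "globular_cell X B \<Longrightarrow> \<exists>q. \<forall>e. B e q = X"
proof
  assume X: "globular_cell X B"
  show "\<forall>e. B e (Max (card ` X)) = X"
    by (intro allI globular_boundary_eq[OF X]) (use globular_cell_finite[OF X] in \<open>simp add: le_SucI\<close>)
qed

lemma cell_dim_simplex_cat_pos_iff:
  assumes "globular_cell X B" "\<Union>X \<subseteq> {..n}"
  shows "0 < cell_dim (simplex_cat n) X \<longleftrightarrow> (\<forall>v. X \<noteq> {{v}})"
proof -
  let ?P = "\<lambda>q. B True q = X \<and> B False q = X"
  have dim: "cell_dim (simplex_cat n) X = Least ?P"
    by (simp add: cell_dim_def simplex_cat_boundary[OF assms])
  obtain q where "?P q"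
    using globular_cell_boundary_eventually[OF assms(1)] by blast
  then have "?P (Least ?P)" by (rule LeastI)
  then have "Least ?P = 0 \<longleftrightarrow> ?P 0"
    using Least_eq_0[of ?P] by auto
  also have "\<dots> \<longleftrightarrow> (\<exists>v. X = {{v}})"
  proof
    assume "?P 0"
    then have "B True 0 = X" ..
    then have "X = {{Max (\<Union>X)}}"
      using globular_cell_extremal_vertices(3)[OF assms(1)] by (rule subst)
    then show "\<exists>v. X = {{v}}" by (rule exI)
  next
    assume "\<exists>v. X = {{v}}"
    then show "?P 0"
      using globular_cell_extremal_vertices(3,4)[OF assms(1)] by auto
  qed
  finally show ?thesis
    unfolding dim by auto
qed

lemma cells_path_simplex_cat_iff:
  "X \<in> cells (path_cat (simplex_cat n))
     \<longleftrightarrow> (\<exists>B. globular_cell X B) \<and> \<Union>X \<subseteq> {..n} \<and> (\<forall>v. X \<noteq> {{v}})"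
  using cell_dim_simplex_cat_pos_iff by (auto simp: path_cat_def cells_simplex_cat_iff)

lemma globular_cell_two_vertices:
  assumes "globular_cell X B" "\<forall>v. X \<noteq> {{v}}"
  shows "Min (\<Union>X) < Max (\<Union>X)"
proof (rule ccontr)
  note ext = globular_cell_extremal_vertices[OF assms(1)]
  assume "\<not> Min (\<Union>X) < Max (\<Union>X)"
  then have "u = Max (\<Union>X)" if "u \<in> \<Union>X" for u
    using Min_le[OF ext(1) that] Max_ge[OF ext(1) that] by linarith
  then have "\<Union>X \<subseteq> {Max (\<Union>X)}" by blast
  then have "X \<subseteq> {{Max (\<Union>X)}}"
    using globular_cell_face[OF assms(1)] by blast
  then show False
    using assms(2) globular_cell_nonempty[OF assms(1)] by (metis subset_singletonD)
qed

lemma cells_simplex_cat_subfaces: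
  assumes "simplex_face m x"
  shows "subfaces x \<in> cells (simplex_cat m)"
  using assms globular_cell_subfaces[of x] finite_subset[of x "{..m}"]
  unfolding cells_simplex_cat_iff simplex_face_def subfaces_def by blast

lemma cells_simplex_cat_map:
  assumes "X \<in> cells (simplex_cat m)" "mono f" "f ` {..m} \<subseteq> {..k}"
  shows "simplex_map f X \<in> cells (simplex_cat k)"
proof -
  have "\<Union>(simplex_map f X) = f ` \<Union>X"
    by (auto simp: simplex_map_def)
  then show ?thesis
    using assms globular_cell_simplex_map[OF assms(2)] unfolding cells_simplex_cat_iff by blast
qed

lemma simplex_cat_face: "Z \<in> cells (simplex_cat m) \<Longrightarrow> s \<in> Z \<Longrightarrow> simplex_face m s"
  using globular_cell_face unfolding cells_simplex_cat_iff simplex_face_def by blast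

lemma functor_boundary:
  assumes x: "x \<in> omega_functors (simplex_cat m) (path_cat (simplex_cat n))"
    and Z: "globular_cell Z C" "\<Union>Z \<subseteq> {..m}"
  shows "\<exists>B. globular_cell (x Z) B \<and> \<Union>(x Z) \<subseteq> {..n} \<and> (\<forall>v. x Z \<noteq> {{v}}) \<and> (\<forall>e q. B e (Suc q) = x (C e q))"
proof -
  have cell: "Z \<in> cells (simplex_cat m)" using Z unfolding cells_simplex_cat_iff by blast
  then have "x Z \<in> cells (path_cat (simplex_cat n))"
    using x unfolding omega_functors_def by (auto dest: PiE_mem)
  then obtain B where B: "globular_cell (x Z) B" "\<Union>(x Z) \<subseteq> {..n}" "\<forall>v. x Z \<noteq> {{v}}"
    unfolding cells_path_simplex_cat_iff by blast
  have "x (src (simplex_cat m) q Z) = src (simplex_cat n) (Suc q) (x Z)"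
       "x (tgt (simplex_cat m) q Z) = tgt (simplex_cat n) (Suc q) (x Z)" for q
    using x cell unfolding omega_functors_def path_cat_def by simp_all
  then have "B e (Suc q) = x (C e q)" for e q
    by (cases e) (simp_all add: simplex_cat_boundary[OF Z] simplex_cat_boundary[OF B(1,2)])
  then show ?thesis using B by blast
qed

lemma functor_comp:
  assumes x: "x \<in> omega_functors (simplex_cat m) (path_cat (simplex_cat n))"
    and X: "globular_cell X A" "\<Union>X \<subseteq> {..m}" and Y: "globular_cell Y B" "\<Union>Y \<subseteq> {..m}"
    and p: "A False p = B True p"
  shows "x (X \<union> Y) = x X \<union> x Y"
proof -
  have cells: "X \<in> cells (simplex_cat m)" "Y \<in> cells (simplex_cat m)"
    using X Y unfolding cells_simplex_cat_iff by blast+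
  have "tgt (simplex_cat m) p X = src (simplex_cat m) p Y"
    using p by (simp add: simplex_cat_boundary[OF X] simplex_cat_boundary[OF Y])
  moreover have "\<forall>i. \<forall>X\<in>cells (simplex_cat m). \<forall>Y\<in>cells (simplex_cat m).
      tgt (simplex_cat m) i X = src (simplex_cat m) i Y \<longrightarrow>
      x (gcomp (simplex_cat m) i X Y) = gcomp (path_cat (simplex_cat n)) i (x X) (x Y)"
    using x unfolding omega_functors_def by simp
  ultimately have "x (gcomp (simplex_cat m) p X Y) = gcomp (path_cat (simplex_cat n)) p (x X) (x Y)"
    using cells by blast
  then show ?thesis by (simp add: path_cat_def simplex_cat_def)
qed

text \<open>Composites are unions on both sides. For an atom it suffices that values on proper
  subfaces are contained in its value: a proper subface lies in the source or the target, whose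
  value is a boundary of the value of the atom.\<close>

lemma functor_eq_Union_atoms:
  assumes x: "x \<in> omega_functors (simplex_cat m) (path_cat (simplex_cat n))"
  shows "globular_cell Z C \<Longrightarrow> \<Union>Z \<subseteq> {..m} \<Longrightarrow> x Z = (\<Union>s\<in>Z. x (subfaces s))"
proof (induction rule: globular_cell.induct)
  case (vertex v)
  then show ?case by (simp add: subfaces_singleton)
next
  case (atom s p C)
  let ?B = "\<lambda>e q. if q < p then C e e q else if q = p then subfaces_of (oriented_faces e s) else subfaces s"
  have cell: "globular_cell (subfaces s) ?B"
    by (rule globular_cell.atom) (use atom.hyps in auto)
  have s: "s \<in> subfaces s" using atom.hyps(2) by (auto simp: mem_subfaces)
  have "x (subfaces r) \<subseteq> x (subfaces s)" if r: "r \<in> subfaces s" for r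
  proof (cases "r = s")
    case False
    then obtain v where v: "v \<in> s - r" using r by (auto simp: mem_subfaces)
    define c where "c = odd (entry_position s v)"
    have rc: "r \<in> subfaces_of (oriented_faces c s)"
      using r v by (auto simp: mem_subfaces_of_oriented_faces mem_subfaces c_def)
    have "x (subfaces_of (oriented_faces c s)) = (\<Union>t\<in>subfaces_of (oriented_faces c s). x (subfaces t))"
      by (rule atom.IH) (use atom.prems subfaces_of_oriented_faces_subset in blast)
    then have "x (subfaces r) \<subseteq> x (subfaces_of (oriented_faces c s))"
      using rc by blast
    moreover obtain B where "globular_cell (x (subfaces s)) B" "\<forall>e q. B e (Suc q) = x (?B e q)"
      using functor_boundary[OF x cell atom.prems] by blast
    then have "x (subfaces_of (oriented_faces c s)) \<subseteq> x (subfaces s)"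
      using globular_boundary_subset[of "x (subfaces s)" B c "Suc p"] by simp
    ultimately show ?thesis by blast
  qed simp
  then show ?case using s by blast
next
  case (comp X A Y B p)
  have "x (X \<union> Y) = x X \<union> x Y"
    by (rule functor_comp[OF x comp.hyps(1) _ comp.hyps(2) _ comp.hyps(3)]) (use comp.prems in auto)
  moreover have "\<Union>X \<subseteq> {..m}" "\<Union>Y \<subseteq> {..m}" using comp.prems by auto
  ultimately show ?case using comp.IH by blast
qed

lemma functor_cell_eq_Union_atoms:
  assumes "x \<in> omega_functors (simplex_cat m) (path_cat (simplex_cat n))" "Z \<in> cells (simplex_cat m)"
  shows "x Z = (\<Union>s\<in>Z. x (subfaces s))"
  using functor_eq_Union_atoms[OF assms(1)] assms(2) unfolding cells_simplex_cat_iff by blast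

lemma functor_atom_mono:
  assumes "x \<in> omega_functors (simplex_cat m) (path_cat (simplex_cat n))"
    and "simplex_face m s" "r \<subseteq> s" "r \<noteq> {}"
  shows "x (subfaces r) \<subseteq> x (subfaces s)"
proof -
  have "r \<in> subfaces s" using assms(3,4) by (simp add: mem_subfaces)
  then show ?thesis
    using functor_cell_eq_Union_atoms[OF assms(1) cells_simplex_cat_subfaces[OF assms(2)]] by blast
qed

text \<open>Extracts from a functor the conditions that \<open>atom_assignment\<close> asks of a
  family of values. A face of dimension \<open>card s - 1\<close> has a value of dimension at most
  \<open>card s\<close>, since the path category lowers dimensions by one.\<close>

lemma functor_atom:
  assumes x: "x \<in> omega_functors (simplex_cat m) (path_cat (simplex_cat n))" and s: "simplex_face m s"
  obtains B where "globular_cell (x (subfaces s)) B" "\<Union>(x (subfaces s)) \<subseteq> {..n}"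
    "\<forall>v. x (subfaces s) \<noteq> {{v}}"
    "\<And>e q. card s \<le> q \<Longrightarrow> B e q = x (subfaces s)"
    "\<And>e p. card s = Suc (Suc p) \<Longrightarrow> B e (Suc p) = (\<Union>r\<in>subfaces_of (oriented_faces e s). x (subfaces r))"
proof -
  have fin: "finite s" and ne: "s \<noteq> {}" and sub: "s \<subseteq> {..m}"
    using s finite_subset[of s "{..m}"] by (auto simp: simplex_face_def)
  obtain C where C: "globular_cell (subfaces s) C"
    using globular_cell_subfaces[OF fin ne] by blast
  have sub': "\<Union>(subfaces s) \<subseteq> {..m}" using sub unfolding subfaces_def by blast
  obtain B where B: "globular_cell (x (subfaces s)) B" "\<Union>(x (subfaces s)) \<subseteq> {..n}"
      "\<forall>v. x (subfaces s) \<noteq> {{v}}" "\<forall>e q. B e (Suc q) = x (C e q)"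
    using functor_boundary[OF x C sub'] by blast
  show thesis
  proof (rule that[OF B(1,2,3)])
    fix e q assume q: "card s \<le> q"
    then obtain r where r: "q = Suc r" using fin ne by (cases q) auto
    have "C e r = subfaces s"
    proof (rule globular_boundary_eq[OF C])
      fix t assume "t \<in> subfaces s"
      then have "card t \<le> card s" using card_mono[OF fin] by (simp add: mem_subfaces)
      then show "card t \<le> Suc r" using q r by simp
    qed
    then show "B e q = x (subfaces s)" using B(4) r by simp
  next
    fix e p assume p: "card s = Suc (Suc p)"
    have bd: "C e p = subfaces_of (oriented_faces e s)"
      by (rule globular_cell_subfaces_boundary[OF C fin p])
    have "subfaces_of (oriented_faces e s) \<in> cells (simplex_cat m)"
      using globular_cell_boundary[OF C, of e p] subfaces_of_oriented_faces_subset[of e s] sub'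
      unfolding cells_simplex_cat_iff bd by blast
    then show "B e (Suc p) = (\<Union>r\<in>subfaces_of (oriented_faces e s). x (subfaces r))"
      using functor_cell_eq_Union_atoms[OF x] B(4) bd by simp
  qed
qed

text \<open>Boundaries in the path category are boundaries of positive dimension in the simplex, and
  these keep the 0-source and 0-target. So a face and each of its extremal vertices have values with
  the same extremal vertices: a functor stays in one component.\<close>

lemma functor_atom_extremal_vertices:
  assumes x: "x \<in> omega_functors (simplex_cat m) (path_cat (simplex_cat n))" and s: "simplex_face m s"
  shows "Max (\<Union>(x (subfaces s))) = Max (\<Union>(x (subfaces {0})))"
    and "Min (\<Union>(x (subfaces s))) = Min (\<Union>(x (subfaces {0})))"
proof -
  have vertex: "Max (\<Union>(x (subfaces t))) = Max (\<Union>(x (subfaces {v}))) \<and>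
      Min (\<Union>(x (subfaces t))) = Min (\<Union>(x (subfaces {v})))"
    if t: "simplex_face m t" and v: "v = Max t \<or> v = Min t" for t v
  proof -
    have fin: "finite t" and ne: "t \<noteq> {}" and sub: "\<Union>(subfaces t) \<subseteq> {..m}"
      using t finite_subset[of t "{..m}"] by (auto simp: simplex_face_def subfaces_def)
    obtain C where C: "globular_cell (subfaces t) C"
      using globular_cell_subfaces[OF fin ne] by blast
    have "\<Union>(subfaces t) = t" using ne by (auto simp: subfaces_def)
    then have "\<exists>e. C e 0 = {{v}}"
      using globular_cell_extremal_vertices(3,4)[OF C] v by auto
    then obtain e where e: "C e 0 = subfaces {v}" by (auto simp: subfaces_singleton)
    obtain B where B: "globular_cell (x (subfaces t)) B" "\<forall>e q. B e (Suc q) = x (C e q)"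
      using functor_boundary[OF x C sub] by blast
    have B1: "globular_cell (x (subfaces {v})) (truncate_boundary (Suc 0) (x (subfaces {v})) B)"
      using globular_cell_boundary[OF B(1), of e "Suc 0"] B(2) e by simp
    then show ?thesis
      using globular_cell_extremal_vertices(3,4)[OF B(1)] globular_cell_extremal_vertices(3,4)[OF B1]
      by (simp add: truncate_boundary_def)
  qed
  have fin: "finite s" and ne: "s \<noteq> {}" and sub: "s \<subseteq> {..m}"
    using s finite_subset[of s "{..m}"] by (auto simp: simplex_face_def)
  have "Max s \<in> s" using fin ne by simp
  \<comment> \<open>The edge from \<open>Max s\<close> to 0 links \<open>s\<close> to the vertex 0;
    it may degenerate to \<open>{0}\<close>.\<close>
  then have "simplex_face m {0, Max s}" using sub by (auto simp: simplex_face_def)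
  moreover have "Max {0, Max s} = Max s" "Min {0, Max s} = 0" by simp_all
  ultimately show "Max (\<Union>(x (subfaces s))) = Max (\<Union>(x (subfaces {0})))"
    "Min (\<Union>(x (subfaces s))) = Min (\<Union>(x (subfaces {0})))"
    using vertex[OF s, of "Max s"] vertex[of "{0, Max s}" "Max s"] vertex[of "{0, Max s}" 0] by simp_all
qed

text \<open>Only boundaries in the top dimensions are prescribed; the lower ones follow from
  uniqueness. With \<open>mono\<close>, the union of the values over all subfaces of
  \<open>s\<close> is \<open>g s\<close>, so extension by unions really extends
  \<open>g\<close>.\<close>

locale atom_assignment =
  fixes m n :: nat and g :: "nat set \<Rightarrow> nat set set"
  assumes mono: "\<And>r s. simplex_face m s \<Longrightarrow> r \<subseteq> s \<Longrightarrow> r \<noteq> {} \<Longrightarrow> g r \<subseteq> g s"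
    and atom_cell: "\<And>s. simplex_face m s \<Longrightarrow> \<exists>B. globular_cell (g s) B \<and> \<Union>(g s) \<subseteq> {..n} \<and> (\<forall>v. g s \<noteq> {{v}})
      \<and> (\<forall>e q. card s \<le> q \<longrightarrow> B e q = g s)
      \<and> (\<forall>e p. card s = Suc (Suc p) \<longrightarrow> B e (Suc p) = \<Union>(g ` subfaces_of (oriented_faces e s)))"
begin

lemma subfaces_value:
  assumes "simplex_face m s"
  shows "\<Union>(g ` subfaces s) = g s"
proof
  show "\<Union>(g ` subfaces s) \<subseteq> g s"
    using mono[OF assms] unfolding subfaces_def by blast
  have "s \<in> subfaces s"
    using assms by (simp add: mem_subfaces simplex_face_def)
  then show "g s \<subseteq> \<Union>(g ` subfaces s)" by blast
qed

lemma extension_cell: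
  "globular_cell Z C \<Longrightarrow> \<Union>Z \<subseteq> {..m} \<Longrightarrow>
     \<exists>B. globular_cell (\<Union>(g ` Z)) B \<and> \<Union>(\<Union>(g ` Z)) \<subseteq> {..n} \<and> (\<forall>e q. B e (Suc q) = \<Union>(g ` C e q))"
proof (induction rule: globular_cell.induct)
  case (vertex v)
  then have "simplex_face m {v}" by (simp add: simplex_face_def subfaces_singleton)
  then show ?case
    using atom_cell[of "{v}"] by (auto simp: subfaces_singleton)
next
  case (atom s p C)
  have sf: "simplex_face m s" using atom.hyps(2) atom.prems by (auto simp: simplex_face_def subfaces_def)
  obtain B where cell: "globular_cell (g s) B \<and> \<Union>(g s) \<subseteq> {..n} \<and> (\<forall>v. g s \<noteq> {{v}})
      \<and> (\<forall>e q. card s \<le> q \<longrightarrow> B e q = g s)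
      \<and> (\<forall>e p. card s = Suc (Suc p) \<longrightarrow> B e (Suc p) = \<Union>(g ` subfaces_of (oriented_faces e s)))"
    using atom_cell[OF sf] by (rule exE)
  then have B: "globular_cell (g s) B" "\<Union>(g s) \<subseteq> {..n}"
      "card s \<le> q \<Longrightarrow> B e q = g s"
      "B e (Suc p) = \<Union>(g ` subfaces_of (oriented_faces e s))" for e q
    using atom.hyps(2) by simp_all
  have bd: "B e (Suc q) = \<Union>(g ` (if q < p then C e e q
      else if q = p then subfaces_of (oriented_faces e s) else subfaces s))" for e q
  proof -
    consider "q < p" | "q = p" | "p < q" by linarith
    then show ?thesis
    proof cases
      case 1
      have "\<Union>(subfaces_of (oriented_faces e s)) \<subseteq> {..m}"
        using atom.prems subfaces_of_oriented_faces_subset[of e s] by blast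
      then obtain D where D: "globular_cell (\<Union>(g ` subfaces_of (oriented_faces e s))) D"
          "\<forall>d q. D d (Suc q) = \<Union>(g ` C e d q)"
        using atom.IH[of e] by blast
      \<comment> \<open>The value on the source or target of \<open>s\<close> carries two sets of
        boundary data, one from \<open>g s\<close> and one from the induction hypothesis. Uniqueness
        equates them, which yields the boundaries that are not prescribed.\<close>
      have "truncate_boundary (Suc p) (B e (Suc p)) B = D"
        by (rule globular_cell_unique[OF globular_cell_boundary[OF B(1)]]) (use B(4) D(1) in simp)
      then have "D e (Suc q) = B e (Suc q)" using 1 by (auto simp: truncate_boundary_def)
      then show ?thesis using D(2) 1 by simp
    next
      case 2
      then show ?thesis using B(4) by simp
    next
      case 3
      then show ?thesis using B(3) atom.hyps(2) subfaces_value[OF sf] by simp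
    qed
  qed
  show ?case
  proof (intro exI[of _ B] conjI allI)
    show "globular_cell (\<Union>(g ` subfaces s)) B" "\<Union>(\<Union>(g ` subfaces s)) \<subseteq> {..n}"
      using B(1,2) by (simp_all only: subfaces_value[OF sf])
  qed (rule bd)
next
  case (comp X A Y B p)
  have "\<Union>X \<subseteq> {..m}" "\<Union>Y \<subseteq> {..m}" using comp.prems by auto
  note IH = comp.IH(1)[OF this(1)] comp.IH(2)[OF this(2)]
  obtain A' where A': "globular_cell (\<Union>(g ` X)) A'" "\<Union>(\<Union>(g ` X)) \<subseteq> {..n}"
      "\<forall>e q. A' e (Suc q) = \<Union>(g ` A e q)"
    using IH(1) by (elim exE conjE)
  obtain B' where B': "globular_cell (\<Union>(g ` Y)) B'" "\<Union>(\<Union>(g ` Y)) \<subseteq> {..n}"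
      "\<forall>e q. B' e (Suc q) = \<Union>(g ` B e q)"
    using IH(2) by (elim exE conjE)
  have p: "A' False (Suc p) = B' True (Suc p)"
    using comp.hyps(3) A'(3) B'(3) by simp
  let ?D = "\<lambda>e q. if Suc p < q then A' e q \<union> B' e q else if e then A' e q else B' e q"
  have XY: "\<Union>(g ` (X \<union> Y)) = \<Union>(g ` X) \<union> \<Union>(g ` Y)"
    by (simp add: image_Un)
  show ?case
  proof (intro exI[of _ ?D] conjI allI)
    show "globular_cell (\<Union>(g ` (X \<union> Y))) ?D"
      unfolding XY by (rule globular_cell.comp[OF A'(1) B'(1) p]) (rule globular_boundary_agree[OF A'(1) B'(1) p])
    show "\<Union>(\<Union>(g ` (X \<union> Y))) \<subseteq> {..n}"
      unfolding XY using A'(2) B'(2) by simp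
    show "?D e (Suc q) = \<Union>(g ` (if p < q then A e q \<union> B e q else if e then A e q else B e q))" for e q
      using A'(3) B'(3) by (simp add: image_Un)
  qed
qed

lemma extension_functor:
  "(\<lambda>Z\<in>cells (simplex_cat m). \<Union>(g ` Z)) \<in> omega_functors (simplex_cat m) (path_cat (simplex_cat n))"
  (is "?f \<in> _")
proof -
  have img: "?f Z \<in> cells (path_cat (simplex_cat n))"
      "?f (src (simplex_cat m) i Z) = src (path_cat (simplex_cat n)) i (?f Z)"
      "?f (tgt (simplex_cat m) i Z) = tgt (path_cat (simplex_cat n)) i (?f Z)"
    if Z: "Z \<in> cells (simplex_cat m)" for Z i
  proof -
    obtain C where C: "globular_cell Z C" "\<Union>Z \<subseteq> {..m}"
      using Z unfolding cells_simplex_cat_iff by blast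
    obtain B where B: "globular_cell (\<Union>(g ` Z)) B" "\<Union>(\<Union>(g ` Z)) \<subseteq> {..n}"
        "\<And>e q. B e (Suc q) = \<Union>(g ` C e q)"
      using extension_cell[OF C] by blast
    have Cmem: "C e q \<in> cells (simplex_cat m)" for e q
      using globular_cell_boundary[OF C(1), of e q] globular_boundary_subset[OF C(1), of e q] C(2)
      unfolding cells_simplex_cat_iff by blast
    have "\<Union>(g ` Z) \<noteq> {{v}}" for v
    proof
      assume v: "\<Union>(g ` Z) = {{v}}"
      obtain s where s: "s \<in> Z" using globular_cell_nonempty[OF C(1)] by blast
      obtain D where D: "globular_cell (g s) D" "\<forall>v. g s \<noteq> {{v}}"
        using atom_cell[OF simplex_cat_face[OF Z s]] by blast
      have "g s \<subseteq> {{v}}" using s v by blast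
      then show False
        using D globular_cell_nonempty by (metis subset_singletonD)
    qed
    then show "?f Z \<in> cells (path_cat (simplex_cat n))"
      using B(1,2) Z unfolding cells_path_simplex_cat_iff by auto
    show "?f (src (simplex_cat m) i Z) = src (path_cat (simplex_cat n)) i (?f Z)"
      "?f (tgt (simplex_cat m) i Z) = tgt (path_cat (simplex_cat n)) i (?f Z)"
      using Z Cmem by (simp_all add: simplex_cat_boundary[OF C] path_cat_def simplex_cat_boundary[OF B(1,2)] B(3))
  qed
  have "?f (gcomp (simplex_cat m) i X Y) = gcomp (path_cat (simplex_cat n)) i (?f X) (?f Y)"
    if XY: "X \<in> cells (simplex_cat m)" "Y \<in> cells (simplex_cat m)"
      "tgt (simplex_cat m) i X = src (simplex_cat m) i Y" for X Y i
  proof -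
    obtain A where A: "globular_cell X A" "\<Union>X \<subseteq> {..m}"
      using XY(1) unfolding cells_simplex_cat_iff by blast
    obtain B where B: "globular_cell Y B" "\<Union>Y \<subseteq> {..m}"
      using XY(2) unfolding cells_simplex_cat_iff by blast
    have p: "A False i = B True i"
      using XY(3) by (simp add: simplex_cat_boundary[OF A] simplex_cat_boundary[OF B])
    have "X \<union> Y \<in> cells (simplex_cat m)"
      using globular_cell.comp[OF A(1) B(1) p globular_boundary_agree[OF A(1) B(1) p]] A(2) B(2)
      unfolding cells_simplex_cat_iff by blast
    then show ?thesis
      using XY by (simp add: path_cat_def gcomp_simplex_cat image_Un)
  qed
  then show ?thesis
    unfolding omega_functors_def using img by auto
qed

end

section \<open>The contracting homotopy\<close>

text \<open>The vertex 0 of the larger simplex is new; the old vertices are shifted by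
  \<open>Suc\<close>, so that omitting 0 restores \<open>x\<close>. The new vertex goes to the
  terminal edge of the component. The edge from \<open>Suc v\<close> to 0 then needs a value leading
  from \<open>x (subfaces {v})\<close> to that edge, and the cone is one.\<close>

definition cone_atom :: "(nat set set \<Rightarrow> nat set set) \<Rightarrow> nat set \<Rightarrow> nat set set" where
  "cone_atom x s =
     (if s = {0} then subfaces {Min (\<Union>(x (subfaces {0}))), Max (\<Union>(x (subfaces {0})))}
      else if 0 \<in> s then cone (Min (\<Union>(x (subfaces {0})))) (x (subfaces (Suc -` s)))
      else x (subfaces (Suc -` s)))"

definition cone_functor :: "nat \<Rightarrow> (nat set set \<Rightarrow> nat set set) \<Rightarrow> nat set set \<Rightarrow> nat set set" where
  "cone_functor m x = (\<lambda>Z\<in>cells (simplex_cat (Suc m)). \<Union>(cone_atom x ` Z))"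

lemma Suc_vimage_insert_0: "Suc -` insert 0 (Suc ` t) = t"
  by auto

lemma Suc_vimage_image: "Suc -` Suc ` t = t"
  by auto

lemma cone_atom_0:
  "cone_atom x {0} = subfaces {Min (\<Union>(x (subfaces {0}))), Max (\<Union>(x (subfaces {0})))}"
  by (simp add: cone_atom_def)

lemma cone_atom_Suc: "cone_atom x (Suc ` t) = x (subfaces t)"
  by (auto simp: cone_atom_def Suc_vimage_image)

lemma cone_atom_insert_0:
  assumes "t \<noteq> {}"
  shows "cone_atom x (insert 0 (Suc ` t)) = cone (Min (\<Union>(x (subfaces {0})))) (x (subfaces t))"
proof -
  have "insert 0 (Suc ` t) \<noteq> {0}" using assms by auto
  then show ?thesis by (simp add: cone_atom_def Suc_vimage_insert_0)
qed

lemma simplex_face_Suc_cases: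
  assumes "simplex_face (Suc m) s"
  obtains "s = {0}"
    | t where "simplex_face m t" "s = Suc ` t"
    | t where "simplex_face m t" "s = insert 0 (Suc ` t)"
proof -
  define t where "t = Suc -` s"
  have s: "s = Suc ` t \<or> s = insert 0 (Suc ` t)"
  proof -
    have "s \<subseteq> insert 0 (Suc ` t)"
    proof
      fix v assume "v \<in> s"
      then show "v \<in> insert 0 (Suc ` t)" by (cases v) (auto simp: t_def)
    qed
    then show ?thesis by (auto simp: t_def)
  qed
  show thesis
  proof (cases "t = {}")
    case True
    then show ?thesis using s assms that(1) by (auto simp: simplex_face_def)
  next
    case False
    then have "simplex_face m t" using assms by (auto simp: simplex_face_def t_def)
    then show ?thesis using s that(2,3) by blast
  qed
qed

lemma cone_UN: "I \<noteq> {} \<Longrightarrow> cone a (\<Union>i\<in>I. Y i) = (\<Union>i\<in>I. cone a (Y i))"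
  by (auto simp: cone_def)

context
  fixes m n :: nat and x :: "nat set set \<Rightarrow> nat set set" and a b :: nat
  assumes x: "x \<in> omega_functors (simplex_cat m) (path_cat (simplex_cat n))"
  defines "a \<equiv> Min (\<Union>(x (subfaces {0})))" and "b \<equiv> Max (\<Union>(x (subfaces {0})))"
begin

lemma target_source_of_atom:
  assumes "simplex_face m s" "globular_cell (x (subfaces s)) B"
  shows "B True 0 = {{b}}" "B False 0 = {{a}}" "\<And>v. v \<in> \<Union>(x (subfaces s)) \<Longrightarrow> a \<le> v" "{b} \<in> x (subfaces s)"
proof -
  note ext = globular_cell_extremal_vertices[OF assms(2)]
  note eq = functor_atom_extremal_vertices[OF x assms(1)]
  show B0: "B True 0 = {{b}}" "B False 0 = {{a}}" using ext eq by (simp_all add: a_def b_def)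
  show "a \<le> v" if "v \<in> \<Union>(x (subfaces s))" for v
    unfolding a_def eq(2)[symmetric] using ext(1) that by (rule Min_le)
  show "{b} \<in> x (subfaces s)"
    using globular_boundary_subset[OF assms(2), of True 0] B0 by blast
qed

lemma top_edge_eq_cone: "subfaces {a, b} = cone a {{b}}"
  using cone_subfaces[of "{b}" a] by (simp add: subfaces_singleton)

lemma Union_cone_atom_Suc:
  assumes "globular_cell Z C" "\<Union>Z \<subseteq> {..m}"
  shows "\<Union>(cone_atom x ` simplex_map Suc Z) = x Z"
  using functor_eq_Union_atoms[OF x assms] by (simp add: simplex_map_def image_image cone_atom_Suc)

text \<open>Every value of \<open>x\<close> contains the vertex \<open>b\<close>, so the edge
  assigned to the vertex 0 already lies in the cone over it. Extension by unions therefore takes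
  cones with apex 0 to cones with apex \<open>a\<close>, which matches the boundaries of an atom
  containing 0 with \<open>cone_boundary\<close>.\<close>

lemma Union_cone_atom_cone:
  assumes Z: "globular_cell Z C" "\<Union>Z \<subseteq> {..m}"
  shows "\<Union>(cone_atom x ` cone 0 (simplex_map Suc Z)) = cone a (x Z)"
proof -
  have sub: "simplex_face m s" if "s \<in> Z" for s
    using that globular_cell_face[OF Z(1)] Z(2) by (auto simp: simplex_face_def)
  have ne: "Z \<noteq> {}" by (rule globular_cell_nonempty[OF Z(1)])
  have xZ: "x Z = (\<Union>s\<in>Z. x (subfaces s))"
    by (rule functor_eq_Union_atoms[OF x Z])
  obtain s where s: "s \<in> Z" using ne by blast
  obtain B where "globular_cell (x (subfaces s)) B"
    by (rule functor_atom[OF x sub[OF s]]) (rule that)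
  then have "{b} \<in> x (subfaces s)" by (rule target_source_of_atom(4)[OF sub[OF s]])
  then have "{{b}} \<subseteq> x Z" unfolding xZ using s by blast
  then have edge: "cone_atom x {0} \<subseteq> cone a (x Z)"
    using cone_mono[of "{{b}}" "x Z" a] by (simp add: cone_atom_0 top_edge_eq_cone[unfolded a_def b_def] a_def b_def)
  have "cone 0 (simplex_map Suc Z) = insert {0} (((`) Suc ` Z) \<union> (\<lambda>s. insert 0 (Suc ` s)) ` Z)"
    by (simp add: cone_def simplex_map_def image_image)
  then have "\<Union>(cone_atom x ` cone 0 (simplex_map Suc Z)) =
      cone_atom x {0} \<union> (\<Union>s\<in>Z. cone_atom x (Suc ` s)) \<union> (\<Union>s\<in>Z. cone_atom x (insert 0 (Suc ` s)))"
    by (simp add: image_Un image_image Un_assoc)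
  also have "(\<Union>s\<in>Z. cone_atom x (Suc ` s)) = x Z"
    by (simp add: cone_atom_Suc xZ)
  also have "(\<Union>s\<in>Z. cone_atom x (insert 0 (Suc ` s))) = (\<Union>s\<in>Z. cone a (x (subfaces s)))"
    by (rule SUP_cong[OF refl]) (use sub in \<open>simp add: cone_atom_insert_0 simplex_face_def a_def\<close>)
  also have "\<dots> = cone a (x Z)"
    by (simp add: xZ cone_UN[OF ne])
  finally show ?thesis
    using edge subset_cone[of "x Z" a] by blast
qed

lemma cone_atom_mono:
  assumes s: "simplex_face (Suc m) s" and r: "r \<subseteq> s" "r \<noteq> {}"
  shows "cone_atom x r \<subseteq> cone_atom x s"
  using s
proof (cases rule: simplex_face_Suc_cases)
  case 1
  then show ?thesis using r by (auto simp: subset_singleton_iff)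
next
  case (2 t)
  obtain t' where t': "r = Suc ` t'" "t' \<subseteq> t"
    using r(1) unfolding 2(2) by (auto simp: subset_image_iff)
  then show ?thesis
    using functor_atom_mono[OF x 2(1) t'(2)] r(2) by (simp add: 2(2) cone_atom_Suc)
next
  case (3 t)
  have tne: "t \<noteq> {}" using 3(1) by (simp add: simplex_face_def)
  note cs = cone_atom_insert_0[OF tne, of x, folded a_def, folded 3(2)]
  have "simplex_face (Suc m) r" using s r by (auto simp: simplex_face_def)
  then show ?thesis
  proof (cases rule: simplex_face_Suc_cases)
    case 1
    obtain B where "globular_cell (x (subfaces t)) B"
      by (rule functor_atom[OF x 3(1)]) (rule that)
    then have "{{b}} \<subseteq> x (subfaces t)"
      using target_source_of_atom(4)[OF 3(1)] by blast
    then show ?thesis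
      unfolding 1 cs cone_atom_0 a_def[symmetric] b_def[symmetric] top_edge_eq_cone by (rule cone_mono)
  next
    case (2 t')
    then have "t' \<subseteq> t" "t' \<noteq> {}" using r by (auto simp: 3(2))
    then have "x (subfaces t') \<subseteq> x (subfaces t)" by (rule functor_atom_mono[OF x 3(1)])
    then show ?thesis
      unfolding cs 2(2) cone_atom_Suc using subset_cone by blast
  next
    case t': (3 t')
    then have "t' \<subseteq> t" "t' \<noteq> {}" using r by (auto simp: 3(2) simplex_face_def)
    then have "x (subfaces t') \<subseteq> x (subfaces t)" by (rule functor_atom_mono[OF x 3(1)])
    then show ?thesis
      unfolding cs t'(2) cone_atom_insert_0[OF \<open>t' \<noteq> {}\<close>] a_def by (rule cone_mono)
  qed
qed

lemma atom_boundary_cell: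
  assumes "simplex_face m t" "card t = Suc (Suc p)"
  shows "\<exists>C. globular_cell (subfaces_of (oriented_faces e t)) C"
    and "\<Union>(subfaces_of (oriented_faces e t)) \<subseteq> {..m}"
proof -
  have t: "finite t" "t \<noteq> {}" "t \<subseteq> {..m}"
    using assms(1) finite_subset[of t "{..m}"] by (auto simp: simplex_face_def)
  obtain C where C: "globular_cell (subfaces t) C"
    using globular_cell_subfaces[OF t(1,2)] by blast
  show "\<exists>C. globular_cell (subfaces_of (oriented_faces e t)) C"
    using globular_cell_boundary[OF C, of e p] globular_cell_subfaces_boundary[OF C t(1) assms(2)] by auto
  show "\<Union>(subfaces_of (oriented_faces e t)) \<subseteq> {..m}"
    using t(3) subfaces_of_oriented_faces_subset[of e t] unfolding subfaces_def by blast
qed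

text \<open>Faces without 0 inherit the conditions from \<open>x\<close>. For a face obtained by
  prepending 0 to a shifted face, its source and target and the formulas of
  \<open>cone_boundary\<close> have the same shape, both coming from adding a least vertex.\<close>

lemma cone_atom_assignment: "atom_assignment (Suc m) n (cone_atom x)"
proof
  show "cone_atom x r \<subseteq> cone_atom x s" if "simplex_face (Suc m) s" "r \<subseteq> s" "r \<noteq> {}" for r s
    by (rule cone_atom_mono[OF that])
next
  fix s assume s: "simplex_face (Suc m) s"
  show "\<exists>B. globular_cell (cone_atom x s) B \<and> \<Union>(cone_atom x s) \<subseteq> {..n} \<and> (\<forall>v. cone_atom x s \<noteq> {{v}})
      \<and> (\<forall>e q. card s \<le> q \<longrightarrow> B e q = cone_atom x s)
      \<and> (\<forall>e p. card s = Suc (Suc p) \<longrightarrow> B e (Suc p) = \<Union>(cone_atom x ` subfaces_of (oriented_faces e s)))"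
    using s
  proof (cases rule: simplex_face_Suc_cases)
    case 1
    have "simplex_face m {0}" by (simp add: simplex_face_def)
    from functor_atom[OF x this]
    obtain B where B: "globular_cell (x (subfaces {0})) B" "\<Union>(x (subfaces {0})) \<subseteq> {..n}"
        "\<forall>v. x (subfaces {0}) \<noteq> {{v}}" .
    have ab: "a < b" unfolding a_def b_def by (rule globular_cell_two_vertices[OF B(1,3)])
    have mem: "a \<le> n" "b \<le> n"
      using B(2) Min_in[OF globular_cell_extremal_vertices(1,2)[OF B(1)]]
        Max_in[OF globular_cell_extremal_vertices(1,2)[OF B(1)]] unfolding a_def b_def by blast+
    have cs: "cone_atom x s = subfaces {a, b}"
      by (simp add: 1 cone_atom_0 a_def b_def)
    obtain D where D: "globular_cell (subfaces {a, b}) D"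
      using globular_cell_subfaces[of "{a, b}"] by blast
    show ?thesis
      unfolding cs
    proof (intro exI[of _ D] conjI allI impI)
      show "globular_cell (subfaces {a, b}) D" by (rule D)
      show "\<Union>(subfaces {a, b}) \<subseteq> {..n}" using mem unfolding subfaces_def by auto
      show "subfaces {a, b} \<noteq> {{v}}" for v
      proof
        assume "subfaces {a, b} = {{v}}"
        moreover have "{a} \<in> subfaces {a, b}" "{b} \<in> subfaces {a, b}" by (simp_all add: mem_subfaces)
        ultimately show False using ab by simp
      qed
      show "D e q = subfaces {a, b}" if "card s \<le> q" for e q
      proof (rule globular_boundary_eq[OF D])
        fix y assume "y \<in> subfaces {a, b}"
        then have "card y \<le> card {a, b}" by (intro card_mono) (auto simp: mem_subfaces)
        then show "card y \<le> Suc q" using that ab 1 by simp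
      qed
    qed (simp add: 1)
  next
    case (2 t)
    obtain B where B: "globular_cell (x (subfaces t)) B" "\<Union>(x (subfaces t)) \<subseteq> {..n}"
      "\<forall>v. x (subfaces t) \<noteq> {{v}}"
      "\<And>e q. card t \<le> q \<Longrightarrow> B e q = x (subfaces t)"
      "\<And>e p. card t = Suc (Suc p) \<Longrightarrow> B e (Suc p) = (\<Union>r\<in>subfaces_of (oriented_faces e t). x (subfaces r))"
      by (rule functor_atom[OF x 2(1)]) (rule that)
    have cs: "cone_atom x s = x (subfaces t)" by (simp add: 2(2) cone_atom_Suc)
    have card: "card s = card t" by (simp add: 2(2) card_image)
    have faces: "subfaces_of (oriented_faces e s) = simplex_map Suc (subfaces_of (oriented_faces e t))" for e
      unfolding 2(2) by (rule simplex_map_oriented_faces[symmetric]) (simp_all add: mono_def)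
    have "B e (Suc p) = \<Union>(cone_atom x ` subfaces_of (oriented_faces e s))" if "card s = Suc (Suc p)" for e p
      using B(5) that by (simp add: card faces simplex_map_def image_image cone_atom_Suc)
    then show ?thesis
      unfolding cs using B(1-4) by (intro exI[of _ B]) (simp add: card)
  next
    case (3 t)
    obtain B where B: "globular_cell (x (subfaces t)) B" "\<Union>(x (subfaces t)) \<subseteq> {..n}"
      "\<forall>v. x (subfaces t) \<noteq> {{v}}"
      "\<And>e q. card t \<le> q \<Longrightarrow> B e q = x (subfaces t)"
      "\<And>e p. card t = Suc (Suc p) \<Longrightarrow> B e (Suc p) = (\<Union>r\<in>subfaces_of (oriented_faces e t). x (subfaces r))"
      by (rule functor_atom[OF x 3(1)]) (rule that)
    let ?Y = "x (subfaces t)"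
    have t: "finite t" "t \<noteq> {}"
      using 3(1) finite_subset[of t "{..m}"] by (auto simp: simplex_face_def)
    note ts = target_source_of_atom[OF 3(1) B(1)]
    have cs: "cone_atom x s = cone a ?Y" by (simp add: 3(2) cone_atom_insert_0[OF t(2)] a_def)
    have card: "card s = Suc (card t)"
      using t(1) by (simp add: 3(2) card_image card_insert_if image_iff)
    have aY: "{a} \<in> ?Y"
      using globular_boundary_subset[OF B(1), of False 0] ts(2) by blast
    have least: "finite (Suc ` t)" "Suc ` t \<noteq> {}" "\<And>v. v \<in> Suc ` t \<Longrightarrow> 0 < v"
      using t by auto
    note faces = subfaces_of_oriented_faces_insert_least[OF least]
    have imgs: "subfaces_of (oriented_faces e (Suc ` t)) = simplex_map Suc (subfaces_of (oriented_faces e t))" for e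
      by (rule simplex_map_oriented_faces[symmetric]) (simp_all add: mono_def)
    have img: "\<Union>(cone_atom x ` subfaces (Suc ` t)) = ?Y"
    proof -
      have "\<Union>(cone_atom x ` simplex_map Suc (subfaces t)) = ?Y"
        using globular_cell_subfaces[OF t] 3(1) Union_cone_atom_Suc[of "subfaces t"]
        unfolding subfaces_def simplex_face_def by blast
      then show ?thesis by (simp add: simplex_map_subfaces)
    qed
    show ?thesis
      unfolding cs
    proof (intro exI[of _ "cone_boundary a B"] conjI allI impI)
      show "globular_cell (cone a ?Y) (cone_boundary a B)"
        by (rule globular_cell_cone[OF B(1) ts(3)])
      have "a \<in> \<Union>?Y" using aY by blast
      then show "\<Union>(cone a ?Y) \<subseteq> {..n}" using B(2) by (auto simp: Union_cone)
      show "cone a ?Y \<noteq> {{v}}" for v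
      proof
        assume "cone a ?Y = {{v}}"
        then have "?Y \<subseteq> {{v}}" using subset_cone[of ?Y a] by simp
        then have "?Y = {{v}}" using globular_cell_nonempty[OF B(1)] by (simp add: subset_singleton_iff)
        then show False using B(3) by blast
      qed
      show "cone_boundary a B e q = cone a ?Y" if q: "card s \<le> q" for e q
      proof -
        have "Suc (card t) \<le> q" using q card by simp
        define r where "r = q - 1"
        have r: "q = Suc r" "card t \<le> r"
          unfolding r_def using \<open>Suc (card t) \<le> q\<close> by linarith+
        have "B d q = ?Y" "B d r = ?Y" for d
          by (rule B(4), use r in simp)+
        then show ?thesis
          using subset_cone[of ?Y a] by (cases e) (simp_all add: r(1) Un_absorb1)
      qed
      fix e p assume p: "card s = Suc (Suc p)"
      then have ct: "card t = Suc p" using card by simp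
      show "cone_boundary a B e (Suc p) = \<Union>(cone_atom x ` subfaces_of (oriented_faces e s))"
      proof (cases p)
        case 0
        \<comment> \<open>The general formula for the source needs a face \<open>t\<close> with two
          entries, so the edge is treated by itself: its source gives \<open>?Y\<close>, as the apex
          is already in \<open>?Y\<close>, and its target gives the terminal edge.\<close>
        then obtain v where v: "t = {v}" using ct by (auto simp: card_1_singleton_iff)
        have "s = {0, Suc v}" by (simp add: 3(2) v)
        note edge = oriented_faces_edge[of 0 "Suc v", folded this]
        have "cone_atom x {Suc v} = ?Y" using cone_atom_Suc[of x "{v}"] by (simp add: v)
        moreover have "B e (Suc 0) = ?Y" for e using B(4) ct 0 by simp
        moreover have "cone_atom x {0} = cone a {{b}}"
          unfolding top_edge_eq_cone[symmetric] by (simp add: cone_atom_0 a_def b_def)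
        ultimately show ?thesis
          using 0 ts(1,2) aY edge by (cases e) (simp_all add: subfaces_singleton cone_vertex insert_absorb)
      next
        case (Suc r)
        then have ct': "card t = Suc (Suc r)" using ct by simp
        obtain C where C: "\<And>e. globular_cell (subfaces_of (oriented_faces e t)) (C e)"
          using atom_boundary_cell(1)[OF 3(1) ct'] by metis
        note sub = atom_boundary_cell(2)[OF 3(1) ct']
        have Bp: "B e p = x (subfaces_of (oriented_faces e t))" for e
          using B(5)[OF ct'] functor_eq_Union_atoms[OF x C sub] Suc by simp
        have "B True (Suc p) = ?Y" using B(4) ct by simp
        then show ?thesis
          using faces(1) faces(2)[of r] ct' Union_cone_atom_cone[OF C sub] img
          by (cases e) (simp_all add: 3(2) imgs Bp card_image image_Un)
      qed
    qed
  qed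
qed

lemma cone_functor_in: "cone_functor m x \<in> omega_functors (simplex_cat (Suc m)) (path_cat (simplex_cat n))"
  unfolding cone_functor_def by (rule atom_assignment.extension_functor[OF cone_atom_assignment])

end

text \<open>Boundaries are closed under the group operations, so the subgroup generated by the
  cycles stays inside them, and each of its cosets collapses to the set of boundaries
  itself.\<close>

lemma trivial_group_aug_homologyI:
  assumes "cycles X m \<subseteq> boundaries X m"
  shows "trivial_group (aug_homology X m)"
proof -
  let ?H = "boundaries X m" and ?G = "chain_group X m"
  let ?S = "subgroup_generated ?G (cycles X m)"
  have mult: "u \<otimes>\<^bsub>?S\<^esub> v = u + v" "u \<otimes>\<^bsub>?G\<^esub> v = u + v" for u v
    by (simp_all add: subgroup_generated_def chain_group_def free_Abelian_group_def)
  have linear: "boundary X (Suc m) (u + v) = boundary X (Suc m) u + boundary X (Suc m) v"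
    "boundary X (Suc m) (u - v) = boundary X (Suc m) u - boundary X (Suc m) v"
    "boundary X (Suc m) (- u) = - boundary X (Suc m) u" "boundary X (Suc m) 0 = 0" for u v
    by (simp_all add: boundary_def frag_extend_add frag_extend_diff frag_extend_minus)
  have C: "u + v \<in> carrier (chain_group X k)" "u - v \<in> carrier (chain_group X k)"
      "- u \<in> carrier (chain_group X k)" "0 \<in> carrier (chain_group X k)"
    if "u \<in> carrier (chain_group X k)" "v \<in> carrier (chain_group X k)" for u v k
    using that keys_add[of u v] keys_diff[of u v] by (auto simp: chain_group_def free_Abelian_group_def)
  have H: "u + v \<in> ?H" "u - v \<in> ?H" "- u \<in> ?H" if uv: "u \<in> ?H" "v \<in> ?H" for u v
  proof -
    obtain u' v' where u': "u = boundary X (Suc m) u'" "u' \<in> carrier (chain_group X (Suc m))"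
      and v': "v = boundary X (Suc m) v'" "v' \<in> carrier (chain_group X (Suc m))"
      using uv unfolding boundaries_def by (elim imageE)
    show "u + v \<in> ?H" "u - v \<in> ?H" "- u \<in> ?H"
      unfolding boundaries_def u'(1) v'(1) linear[symmetric] by (rule imageI, rule C[OF u'(2) v'(2)])+
  qed
  have "0 \<in> carrier (chain_group X (Suc m))"
    by (simp add: chain_group_def free_Abelian_group_def)
  then have H0: "0 \<in> ?H"
    unfolding boundaries_def using linear(4) by (metis imageI)
  have carrier_sub: "carrier ?S \<subseteq> ?H"
  proof
    fix u assume "u \<in> carrier ?S"
    then have "u \<in> generate ?G (carrier ?G \<inter> cycles X m)"
      by (simp add: carrier_subgroup_generated)
    then show "u \<in> ?H"
    proof (induction rule: generate.induct)
      case one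
      then show ?case using H0 by (simp add: chain_group_def free_Abelian_group_def)
    next
      case (incl h)
      then show ?case using assms by blast
    next
      case (inv h)
      then have "inv\<^bsub>?G\<^esub> h = - h"
        by (simp add: chain_group_def)
      then show ?case using inv H(3) assms by auto
    next
      case (eng h1 h2)
      then show ?case using H(1) by (simp add: chain_group_def free_Abelian_group_def)
    qed
  qed
  have coset: "?H #>\<^bsub>?S\<^esub> u = ?H" if "u \<in> ?H" for u
  proof
    show "?H #>\<^bsub>?S\<^esub> u \<subseteq> ?H"
      using H(1) that by (auto simp: r_coset_def mult)
    show "?H \<subseteq> ?H #>\<^bsub>?S\<^esub> u"
    proof
      fix v assume "v \<in> ?H"
      then have "v - u \<in> ?H" "v = (v - u) + u" using H(2) that by auto
      then show "v \<in> ?H #>\<^bsub>?S\<^esub> u" unfolding r_coset_def mult by blast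
    qed
  qed
  have "carrier ?S \<noteq> {}"
    by (auto simp: carrier_subgroup_generated intro: generate.one)
  then have carrier: "carrier (aug_homology X m) = {?H}"
    using coset carrier_sub by (auto simp: aug_homology_def FactGroup_def RCOSETS_def)
  have one: "\<one>\<^bsub>aug_homology X m\<^esub> = ?H"
    by (simp add: aug_homology_def FactGroup_def)
  have "?H <#>\<^bsub>?S\<^esub> ?H = (\<Union>u\<in>?H. ?H #>\<^bsub>?S\<^esub> u)"
    by (auto simp: set_mult_def r_coset_def)
  also have "\<dots> = ?H" using coset H0 by auto
  finally have prod: "?H \<otimes>\<^bsub>aug_homology X m\<^esub> ?H = ?H"
    by (simp add: aug_homology_def FactGroup_def)
  have "group (aug_homology X m)"
    by (rule groupI) (simp_all add: carrier one prod)
  then show ?thesis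
    by (simp add: trivial_group_def carrier one)
qed

section \<open>The extra degeneracy and the contraction of the chain complex\<close>

lemma frag_extend_frag_extend:
  "frag_extend f (frag_extend g c) = frag_extend (\<lambda>x. frag_extend f (g x)) c"
  unfolding frag_extend_def[of g] frag_extend_def[of "\<lambda>x. frag_extend f (g x)"]
  by (simp add: frag_extend_sum frag_extend_cmul)

lemma mono_coface: "mono (coface i)"
  by (auto simp: mono_def coface_def)

lemma coface_Suc_image: "coface (Suc i) ` Suc ` t = Suc ` coface i ` t"
  by (auto simp: image_image coface_def)

lemma coface_mem: "i \<le> Suc k \<Longrightarrow> coface i ` {..k} \<subseteq> {..Suc k}"
  by (auto simp: coface_def)

context
  fixes m n :: nat and x :: "nat set set \<Rightarrow> nat set set"
  assumes x: "x \<in> omega_functors (simplex_cat m) (path_cat (simplex_cat n))"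
begin

text \<open>\<open>coface 0\<close> is \<open>Suc\<close>, so this face sees only the shifted copy
  of the original simplex. Outside the cells both functions are undefined.\<close>

lemma face_zero_cone_functor: "face (globular_nerve (simplex_cat n)) (Suc m) 0 (cone_functor m x) = x"
proof
  fix Z
  show "face (globular_nerve (simplex_cat n)) (Suc m) 0 (cone_functor m x) Z = x Z"
  proof (cases "Z \<in> cells (simplex_cat m)")
    case True
    then obtain C where C: "globular_cell Z C" "\<Union>Z \<subseteq> {..m}" unfolding cells_simplex_cat_iff by blast
    have "coface 0 = Suc" by (auto simp: coface_def)
    moreover have "simplex_map Suc Z \<in> cells (simplex_cat (Suc m))"
      by (rule cells_simplex_cat_map[OF True]) (auto simp: mono_def)
    ultimately show ?thesis
      using True Union_cone_atom_Suc[OF x C] by (simp add: globular_nerve_def cone_functor_def)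
  next
    case False
    have "x \<in> extensional (cells (simplex_cat m))"
      using x unfolding omega_functors_def PiE_def by blast
    then show ?thesis
      using False by (simp add: globular_nerve_def extensional_def)
  qed
qed

text \<open>\<open>coface (Suc i)\<close> fixes the new vertex 0 and acts as \<open>coface i\<close>
  on the shifted ones. The face of \<open>x\<close> stays in the same component, so the apex and the
  terminal edge do not change.\<close>

lemma face_Suc_cone_functor:
  assumes m: "m = Suc k" and i: "i \<le> m"
  shows "face (globular_nerve (simplex_cat n)) (Suc m) (Suc i) (cone_functor m x)
    = cone_functor k (face (globular_nerve (simplex_cat n)) m i x)"
proof -
  define y where "y = face (globular_nerve (simplex_cat n)) m i x"
  have y: "y (subfaces t) = x (subfaces (coface i ` t))" if t: "simplex_face k t" for t
    using cells_simplex_cat_subfaces[OF t] by (simp add: y_def globular_nerve_def m simplex_map_subfaces)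
  have "simplex_face m {coface i 0}" "simplex_face k {0}"
    using i by (auto simp: m simplex_face_def coface_def)
  then have ext: "Max (\<Union>(y (subfaces {0}))) = Max (\<Union>(x (subfaces {0})))"
      "Min (\<Union>(y (subfaces {0}))) = Min (\<Union>(x (subfaces {0})))"
    using functor_atom_extremal_vertices[OF x] y by simp_all
  have atom: "cone_atom x (coface (Suc i) ` s) = cone_atom y s" if s: "simplex_face m s" for s
    using s unfolding m
  proof (cases rule: simplex_face_Suc_cases)
    case 1
    have "coface (Suc i) ` {0} = {0}" by (simp add: coface_def)
    then show ?thesis unfolding 1 by (simp only: cone_atom_0 ext)
  next
    case (2 t)
    then show ?thesis by (simp add: coface_Suc_image cone_atom_Suc y)
  next
    case (3 t)
    then have "t \<noteq> {}" "coface i ` t \<noteq> {}" by (auto simp: simplex_face_def)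
    moreover have "coface (Suc i) ` s = insert 0 (Suc ` coface i ` t)"
      by (simp add: 3(2) coface_Suc_image[symmetric]) (simp add: coface_def)
    ultimately show ?thesis
      by (simp add: 3 cone_atom_insert_0 y ext)
  qed
  have "cone_functor m x (simplex_map (coface (Suc i)) Z) = cone_functor k y Z"
    if Z: "Z \<in> cells (simplex_cat m)" for Z
  proof -
    have "simplex_map (coface (Suc i)) Z \<in> cells (simplex_cat (Suc m))"
      by (rule cells_simplex_cat_map[OF Z mono_coface coface_mem]) (use i in simp)
    then have "cone_functor m x (simplex_map (coface (Suc i)) Z) = (\<Union>s\<in>Z. cone_atom x (coface (Suc i) ` s))"
      by (simp add: cone_functor_def simplex_map_def image_image)
    also have "\<dots> = (\<Union>s\<in>Z. cone_atom y s)"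
      by (rule SUP_cong[OF refl]) (rule atom[OF simplex_cat_face[OF Z]])
    finally show ?thesis using Z by (simp add: cone_functor_def m)
  qed
  moreover have "cone_functor k y Z = undefined" if "Z \<notin> cells (simplex_cat m)" for Z
    using that by (simp add: cone_functor_def m)
  ultimately show ?thesis
    unfolding y_def[symmetric] by (auto simp: globular_nerve_def fun_eq_iff)
qed

end

text \<open>In degree 0 the last face of the cone on \<open>x\<close> is the terminal edge of its
  component, which depends only on the pair given by the augmentation. The entries of that pair are
  0-cells \<open>{{v}}\<close>, from which the unions recover \<open>{v}\<close>.\<close>

definition constant_edge :: "nat set set \<times> nat set set \<Rightarrow> nat set set \<Rightarrow> nat set set" where
  "constant_edge c = (\<lambda>Z\<in>cells (simplex_cat 0). subfaces (\<Union>(snd c) \<union> \<Union>(fst c)))"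

lemma face_one_cone_functor:
  assumes x: "x \<in> omega_functors (simplex_cat 0) (path_cat (simplex_cat n))"
  shows "face (globular_nerve (simplex_cat n)) (Suc 0) (Suc 0) (cone_functor 0 x)
    = constant_edge (augm (globular_nerve (simplex_cat n)) x)"
proof
  fix Z
  have sf: "simplex_face 0 {0}" by (simp add: simplex_face_def)
  obtain B where B: "globular_cell (x (subfaces {0})) B" "\<Union>(x (subfaces {0})) \<subseteq> {..n}"
    by (rule functor_atom[OF x sf]) (rule that)
  have augm: "augm (globular_nerve (simplex_cat n)) x
      = ({{Max (\<Union>(x (subfaces {0})))}}, {{Min (\<Union>(x (subfaces {0})))}})"
    using globular_cell_extremal_vertices(3,4)[OF B(1)]
    by (simp add: globular_nerve_def simplex_cat_boundary[OF B])
  show "face (globular_nerve (simplex_cat n)) (Suc 0) (Suc 0) (cone_functor 0 x) Z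
    = constant_edge (augm (globular_nerve (simplex_cat n)) x) Z"
  proof (cases "Z \<in> cells (simplex_cat 0)")
    case True
    then obtain C where C: "globular_cell Z C" "\<Union>Z \<subseteq> {..0}" unfolding cells_simplex_cat_iff by blast
    have "s = {0}" if "s \<in> Z" for s
      using that C(2) globular_cell_face[OF C(1) that] by auto
    then have Z: "Z = {{0}}"
      using globular_cell_nonempty[OF C(1)] by blast
    have "simplex_map (coface (Suc 0)) Z \<in> cells (simplex_cat (Suc 0))"
      by (rule cells_simplex_cat_map[OF True mono_coface coface_mem]) simp
    moreover have "simplex_map (coface (Suc 0)) Z = {{0}}"
      by (simp add: Z simplex_map_def coface_def)
    ultimately have "face (globular_nerve (simplex_cat n)) (Suc 0) (Suc 0) (cone_functor 0 x) Z = cone_atom x {0}"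
      using True by (simp add: globular_nerve_def cone_functor_def)
    then show ?thesis
      unfolding augm using True by (simp add: constant_edge_def cone_atom_0 insert_commute)
  next
    case False
    then show ?thesis
      by (simp add: globular_nerve_def constant_edge_def)
  qed
qed

text \<open>The boundary of the cone on \<open>y\<close> is \<open>y - E y\<close>, where
  \<open>E\<close> factors through the boundary, or in degree 0 through the augmentation. On a cycle
  the second term vanishes, so the cycle is the boundary of its cone.\<close>

lemma cycles_subset_boundaries:
  "cycles (globular_nerve (simplex_cat n)) m \<subseteq> boundaries (globular_nerve (simplex_cat n)) m"
proof
  let ?N = "globular_nerve (simplex_cat n)"
  define D where "D k y = (\<Sum>i\<le>k. frag_cmul ((-1) ^ i) (frag_of (face ?N k i y)))" for k y
  define H where "H k = frag_extend (frag_of \<circ> cone_functor k)" for k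
  have boundary: "boundary ?N k = frag_extend (D k)" for k
    unfolding boundary_def by (simp add: D_def[abs_def])
  have simplices: "simplices ?N k = omega_functors (simplex_cat k) (path_cat (simplex_cat n))" for k
    by (simp add: globular_nerve_def)
  fix c assume "c \<in> cycles ?N m"
  then have keys: "Poly_Mapping.keys c \<subseteq> simplices ?N m"
    and zero: "if m = 0 then augmentation ?N c = 0 else boundary ?N m c = 0"
    by (simp_all add: cycles_def chain_group_def free_Abelian_group_def)
  have "Poly_Mapping.keys (H m c) \<subseteq> simplices ?N (Suc m)"
  proof -
    have "Poly_Mapping.keys (H m c) \<subseteq> cone_functor m ` Poly_Mapping.keys c"
      using keys_frag_extend[of "frag_of \<circ> cone_functor m" c] by (auto simp: H_def)
    then show ?thesis
      using keys cone_functor_in unfolding simplices by blast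
  qed
  then have Hc: "H m c \<in> carrier (chain_group ?N (Suc m))"
    by (simp add: chain_group_def free_Abelian_group_def)
  \<comment> \<open>In degree 0 there is no cone one degree lower; the edge determined by the
    augmentation takes its place.\<close>
  define E where "E y = (if m = 0 then frag_of (constant_edge (augm ?N y)) else H (m - 1) (D m y))" for y
  have DH: "D (Suc m) (cone_functor m y) = frag_of y - E y" if y: "y \<in> Poly_Mapping.keys c" for y
  proof -
    have y': "y \<in> omega_functors (simplex_cat m) (path_cat (simplex_cat n))"
      using y keys unfolding simplices by blast
    \<comment> \<open>Splitting off the face of index 0 lowers the remaining indices by one, hence
      the minus sign.\<close>
    have D: "D (Suc m) (cone_functor m y) = frag_of y
        - (\<Sum>i\<le>m. frag_cmul ((-1) ^ i) (frag_of (face ?N (Suc m) (Suc i) (cone_functor m y))))"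
      unfolding D_def sum.atMost_Suc_shift
      by (simp add: face_zero_cone_functor[OF y'] sum_negf[symmetric])
    show ?thesis
    proof (cases m)
      case 0
      then show ?thesis
        using D face_one_cone_functor[of y n] y' by (simp add: E_def)
    next
      case (Suc k)
      have "H k (D m y) = (\<Sum>i\<le>m. frag_cmul ((-1) ^ i) (frag_of (cone_functor k (face ?N m i y))))"
        by (simp add: H_def D_def frag_extend_sum frag_extend_cmul)
      also have "\<dots> = (\<Sum>i\<le>m. frag_cmul ((-1) ^ i) (frag_of (face ?N (Suc m) (Suc i) (cone_functor m y))))"
        by (rule sum.cong) (use face_Suc_cone_functor[OF y' Suc] in auto)
      finally show ?thesis using D Suc by (simp add: E_def)
    qed
  qed
  have "frag_extend E c = 0"
  proof (cases "m = 0")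
    case True
    have "frag_extend E c = frag_extend (frag_of \<circ> constant_edge) (augmentation ?N c)"
      by (simp add: augmentation_def frag_extend_frag_extend E_def[abs_def] True)
    then show ?thesis using zero True by simp
  next
    case False
    have "frag_extend E c = H (m - 1) (boundary ?N m c)"
      using False by (simp add: boundary H_def frag_extend_frag_extend E_def[abs_def])
    then show ?thesis using zero False by (simp add: H_def)
  qed
  have "boundary ?N (Suc m) (H m c) = frag_extend (\<lambda>y. D (Suc m) (cone_functor m y)) c"
    by (simp add: boundary H_def frag_extend_frag_extend)
  also have "\<dots> = frag_extend (\<lambda>y. frag_of y - E y) c"
    by (rule frag_extend_eq) (rule DH)
  also have "\<dots> = frag_extend frag_of c - frag_extend E c"
  proof -
    have "frag_cmul k (u - v) = frag_cmul k u - frag_cmul k v" for k and u v :: "(nat set set \<Rightarrow> nat set set) \<Rightarrow>\<^sub>0 int"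
      using frag_cmul_distrib2[of k "u - v" v] by simp
    then show ?thesis
      unfolding frag_extend_def by (simp add: sum_subtractf)
  qed
  also have "\<dots> = c"
    using \<open>frag_extend E c = 0\<close> frag_expansion[of c] by simp
  finally show "c \<in> boundaries ?N m"
    unfolding boundaries_def using Hc by (metis imageI)
qed

theorem theorem8p7:
  fixes n p :: nat
  assumes "p > 0"
  shows "trivial_group (globular_homology (simplex_cat n) p)"
  unfolding globular_homology_def by (rule trivial_group_aug_homologyI[OF cycles_subset_boundaries])

end
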